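(* Consider a Pitman--Yor process mixture model with parameters $\sigma,\vartheta$ whose family of component distributions is one of the following: (a) $\mathrm{Normal}(\mu,\Sigma)$ (multivariate Gaussian on $\mathbb{R}^d$), (b) $\mathrm{Exponential}(\theta)$, (c) $\mathrm{Gamma}(a,b)$, (d) $\mathrm{Log\text{-}Normal}(\mu,\tau^2)$, or (e) $\mathrm{Weibull}(a,b)$ with fixed shape $a>0$, along with a base measure (prior) that is a conjugate prior $\pi_{\xi,\nu}$ of the form given in the context, with $(\xi,\nu)\in\Xi$; or (f) any discrete family $\{P_\theta:\theta\in\Theta\}$ such that $\bigcap_{\theta\in\Theta}\{x:P_\theta(x)>0\}\neq\varnothing$, along with any continuous base measure (i.e. any prior $\pi$ on $\Theta$ having a density with respect to Lebesgue measure). Consider any $t\in\{1,2,\dots\}$, except for $t=N$ in the case of a Pitman--Yor process with parameters $\sigma<0$ and $\vartheta=N|\sigma|$. If $X_1,X_2,\dots$ are i.i.d. from a mixture with $t$ components from the family used in the model, then the posterior on the number of clusters $T_n$ is not consistent for $t$, and in fact $$\limsup_{n\to\infty}\, p(T_n=t\mid X_1,\dots,X_n)<1\quad\text{with probability }1.$$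
   Context: **Partitions.** For $n\ge 1$ and $1\le t\le n$, $\mathcal{A}_t(n)$ is the set of ordered partitions $(A_1,\dots,A_t)$ of $\{1,\dots,n\}$ into $t$ nonempty disjoint sets. Write $x_{n\uparrow\delta}=x(x+\delta)(x+2\delta)\cdots(x+(n-1)\delta)$, with $x_{0\uparrow\delta}=1$. **Pitman--Yor process mixture model.** The parameters satisfy either $\sigma\in[0,1)$ and $\vartheta\in(-\sigma,\infty)$, or $\sigma\in(-\infty,0)$ and $\vartheta=N|\sigma|$ for some $N\in\{1,2,\dots\}$. For each $n$, the model puts on $\bigcup_{t=1}^n\mathcal{A}_t(n)$ the probability mass function $$p(A)=v_n(t)\prod_{i=1}^t w_n(|A_i|)\ \text{ for } A\in\mathcal{A}_t(n),\qquad v_n(t)=\frac{(\vartheta+\sigma)_{t-1\uparrow\sigma}}{(\vartheta+1)_{n-1\uparrow 1}\,t!},\qquad w_n(a)=(1-\sigma)_{a-1\uparrow 1}.$$ Given $A\in\mathcal{A}_t(n)$, parameters $\theta_1,\dots,\theta_t\in\Theta\subset\mathbb{R}^k$ are i.i.d. from a density $\pi$ with respect to Lebesgue measure (the base measure), and given these, the $x_j$, $j\in A_i$, are independent with density $p_{\theta_i}$ with respect to a sigma-finite Borel measure $\lambda$ on $\mathcal{X}\subset\mathbb{R}^d$; $(\theta,x)\mapsto p_\theta(x)$ is measurable. The single-cluster marginal is $m(x_J)=\int_\Theta\big(\prod_{j\in J}p_\theta(x_j)\big)\pi(\theta)\,d\theta$ for $J\subset\{1,\dots,n\}$, $x_J=(x_j:j\in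 J)$; it is assumed finite, and $m(x_\varnothing)=1$. With $T_n$ the number of clusters (parts of the partition), $$p(x_{1:n},T_n=t)=\sum_{A\in\mathcal{A}_t(n)}p(A)\prod_{i=1}^t m(x_{A_i})$$ (equal to $0$ if $t>n$), and the posterior is $p(T_n=t\mid x_{1:n})=p(x_{1:n},T_n=t)/\sum_{t'\ge1}p(x_{1:n},T_n=t')$ when the denominator is nonzero, and $0$ otherwise. The posterior is consistent for $t$ if $p(T_n=t\mid X_{1:n})\to1$ as $n\to\infty$. **Families (a)--(e) in canonical form, and conjugate priors.** Each is written as $p_\theta(x)=\exp(\theta^{\mathsf T}s(x)-\kappa(\theta))$ with $\kappa(\theta)=\log\int_{\mathcal{X}}\exp(\theta^{\mathsf T}s(x))\,d\lambda(x)$ and $\Theta=\{\theta\in\mathbb{R}^k:\kappa(\theta)<\infty\}$, where: (a) $\mathcal{X}=\mathbb{R}^d$, $\lambda$ Lebesgue, $s(x)=\big((x_i)_{i\le d},(x_ix_j)_{i\le j\le d}\big)$, with $\mu\in\mathbb{R}^d$ and $\Sigma$ symmetric positive definite unrestricted; (b) $\mathcal{X}=(0,\infty)$, $\lambda$ Lebesgue, $s(x)=x$; (c) $\mathcal{X}=(0,\infty)$, $\lambda$ Lebesgue, $s(x)=(\log x,x)$; (d) $\mathcal{X}=(0,\infty)$, $\lambda$ Lebesgue, $s(x)=(\log x,(\log x)^2)$; (e) $\mathcal{X}=(0,\infty)$, $d\lambda(x)=x^{a-1}dx$, $s(x)=x^a$. Let $P_\theta$ be the distribution with density $p_\theta$,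 $\mathcal{M}=\{\mathbb{E}_\theta s(X):\theta\in\Theta\}$ and $\Xi=\{(\xi,\nu):\xi\in\mathbb{R}^k,\ \nu>0,\ \xi/\nu\in\mathcal{M}\}$. For $(\xi,\nu)\in\Xi$ the conjugate prior density with respect to Lebesgue measure is $$\pi_{\xi,\nu}(\theta)=\exp\big(\xi^{\mathsf T}\theta-\nu\kappa(\theta)-\psi(\xi,\nu)\big)I(\theta\in\Theta),\qquad \psi(\xi,\nu)=\log\int_\Theta\exp(\xi^{\mathsf T}\theta-\nu\kappa(\theta))\,d\theta.$$ **Discrete family (f).** $\mathcal{X}$ is countable, $\lambda$ is counting measure, and $P_\theta(x)=p_\theta(x)$ is a probability mass function on $\mathcal{X}$ for each $\theta\in\Theta\subset\mathbb{R}^k$. **Mixture with $t$ components from the family:** a distribution $\sum_{i=1}^t q_iP_{\theta(i)}$ with $\theta(i)\in\Theta$, $q_i\ge0$, $\sum_i q_i=1$. *)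

theory Defs
  imports "HOL-Probability.Probability" "HOL-Library.Uprod"
begin

section \<open>Ordered partitions and the Pitman--Yor partition distribution\<close>

definition ordered_partitions :: "nat \<Rightarrow> nat \<Rightarrow> nat set list set" where
  "ordered_partitions t n =
    {A. length A = t \<and> (\<forall>i<t. A ! i \<noteq> {}) \<and>
        (\<forall>i<t. \<forall>j<t. i \<noteq> j \<longrightarrow> A ! i \<inter> A ! j = {}) \<and>
        (\<Union>i<t. A ! i) = {1..n}}"

definition rising :: "real \<Rightarrow> real \<Rightarrow> nat \<Rightarrow> real" where
  "rising x \<delta> n = (\<Prod>i<n. x + real i * \<delta>)"

text \<open>The concentration parameter is written \<open>\<theta>\<^sub>0\<close>, to keep it apart from component parameters \<open>\<theta>\<close>.\<close>

definition py_params :: "real \<Rightarrow> real \<Rightarrow> bool" where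
  "py_params \<sigma> \<theta>\<^sub>0 \<longleftrightarrow>
    0 \<le> \<sigma> \<and> \<sigma> < 1 \<and> \<theta>\<^sub>0 > - \<sigma> \<or>
    \<sigma> < 0 \<and> (\<exists>N::nat. N \<ge> 1 \<and> \<theta>\<^sub>0 = real N * \<bar>\<sigma>\<bar>)"

definition py_v :: "real \<Rightarrow> real \<Rightarrow> nat \<Rightarrow> nat \<Rightarrow> real" where
  "py_v \<sigma> \<theta>\<^sub>0 n t = rising (\<theta>\<^sub>0 + \<sigma>) \<sigma> (t - 1) / (rising (\<theta>\<^sub>0 + 1) 1 (n - 1) * fact t)"

definition py_w :: "real \<Rightarrow> nat \<Rightarrow> real" where
  "py_w \<sigma> a = rising (1 - \<sigma>) 1 (a - 1)"

definition py_prior :: "real \<Rightarrow> real \<Rightarrow> nat \<Rightarrow> nat set list \<Rightarrow> real" where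
  "py_prior \<sigma> \<theta>\<^sub>0 n A = py_v \<sigma> \<theta>\<^sub>0 n (length A) * (\<Prod>i<length A. py_w \<sigma> (card (A ! i)))"


section \<open>Component families and the mixture model\<close>

text \<open>A family of densities \<open>dens F \<theta>\<close>, \<open>\<theta> \<in> param_space F\<close>, with respect to \<open>base F\<close>.
  The observation space is \<open>space (base F)\<close>; Lebesgue measure on the parameter space
  is \<^const>\<open>lborel\<close>.\<close>

record ('p, 'x) family =
  base :: "'x measure"
  param_space :: "'p set"
  dens :: "'p \<Rightarrow> 'x \<Rightarrow> real"

definition component :: "('p, 'x) family \<Rightarrow> 'p \<Rightarrow> 'x measure" where
  "component F \<theta> = density (base F) (\<lambda>x. ennreal (dens F \<theta> x))"

definition component_family ::
    "('p::euclidean_space, 'x::euclidean_space) family \<Rightarrow> bool" where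
  "component_family F \<longleftrightarrow>
    sigma_finite_measure (base F) \<and>
    sets (base F) = sets (restrict_space borel (space (base F))) \<and>
    param_space F \<in> sets borel \<and>
    (\<lambda>(\<theta>, x). dens F \<theta> x)
      \<in> borel_measurable (restrict_space borel (param_space F) \<Otimes>\<^sub>M base F) \<and>
    (\<forall>\<theta>\<in>param_space F. (\<forall>x\<in>space (base F). 0 \<le> dens F \<theta> x) \<and>
      (\<integral>\<^sup>+x. ennreal (dens F \<theta> x) \<partial>base F) = 1)"

definition prior_density ::
    "('p::euclidean_space, 'x) family \<Rightarrow> ('p \<Rightarrow> real) \<Rightarrow> bool" where
  "prior_density F \<pi> \<longleftrightarrow>
    \<pi> \<in> borel_measurable (restrict_space borel (param_space F)) \<and>
    (\<forall>\<theta>\<in>param_space F. 0 \<le> \<pi> \<theta>) \<and>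
    (\<integral>\<^sup>+\<theta>\<in>param_space F. ennreal (\<pi> \<theta>) \<partial>lborel) = 1"

definition marginal ::
    "('p::euclidean_space, 'x) family \<Rightarrow> ('p \<Rightarrow> real) \<Rightarrow> (nat \<Rightarrow> 'x) \<Rightarrow> nat set \<Rightarrow> ennreal" where
  "marginal F \<pi> x J =
    (if J = {} then 1
     else (\<integral>\<^sup>+\<theta>\<in>param_space F. ennreal ((\<Prod>j\<in>J. dens F \<theta> (x j)) * \<pi> \<theta>) \<partial>lborel))"

definition finite_marginals ::
    "('p::euclidean_space, 'x) family \<Rightarrow> ('p \<Rightarrow> real) \<Rightarrow> bool" where
  "finite_marginals F \<pi> \<longleftrightarrow>
    (\<forall>x J. finite J \<longrightarrow> (\<forall>j\<in>J. x j \<in> space (base F)) \<longrightarrow> marginal F \<pi> x J < \<infinity>)"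

text \<open>Only the values \<open>x 1, \<dots>, x n\<close> of the data sequence enter.\<close>

definition joint ::
    "real \<Rightarrow> real \<Rightarrow> ('p::euclidean_space, 'x) family \<Rightarrow> ('p \<Rightarrow> real) \<Rightarrow>
     nat \<Rightarrow> (nat \<Rightarrow> 'x) \<Rightarrow> nat \<Rightarrow> real" where
  "joint \<sigma> \<theta>\<^sub>0 F \<pi> n x t =
    (\<Sum>A\<in>ordered_partitions t n.
      py_prior \<sigma> \<theta>\<^sub>0 n A * (\<Prod>i<t. enn2real (marginal F \<pi> x (A ! i))))"

text \<open>There are no ordered partitions into \<open>t > n\<close> parts, so the sum over all \<open>t \<ge> 1\<close>
  stops at \<open>n\<close>.\<close>

definition posterior ::
    "real \<Rightarrow> real \<Rightarrow> ('p::euclidean_space, 'x) family \<Rightarrow> ('p \<Rightarrow> real) \<Rightarrow>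
     nat \<Rightarrow> (nat \<Rightarrow> 'x) \<Rightarrow> nat \<Rightarrow> real" where
  "posterior \<sigma> \<theta>\<^sub>0 F \<pi> n x t =
    (let Z = (\<Sum>t'=1..n. joint \<sigma> \<theta>\<^sub>0 F \<pi> n x t')
     in if Z \<noteq> 0 then joint \<sigma> \<theta>\<^sub>0 F \<pi> n x t / Z else 0)"

definition consistent_for ::
    "real \<Rightarrow> real \<Rightarrow> ('p::euclidean_space, 'x) family \<Rightarrow> ('p \<Rightarrow> real) \<Rightarrow>
     (nat \<Rightarrow> 'x) \<Rightarrow> nat \<Rightarrow> bool" where
  "consistent_for \<sigma> \<theta>\<^sub>0 F \<pi> x t \<longleftrightarrow> (\<lambda>n. posterior \<sigma> \<theta>\<^sub>0 F \<pi> n x t) \<longlonglongrightarrow> 1"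


section \<open>Data from a finite mixture\<close>

definition mixture_with :: "nat \<Rightarrow> ('p, 'x) family \<Rightarrow> 'x measure \<Rightarrow> bool" where
  "mixture_with t F Q \<longleftrightarrow>
    (\<exists>(q :: nat \<Rightarrow> real) (\<theta> :: nat \<Rightarrow> 'p).
      (\<forall>i\<in>{1..t}. 0 \<le> q i \<and> \<theta> i \<in> param_space F) \<and> (\<Sum>i=1..t. q i) = 1 \<and>
      sets Q = sets (base F) \<and>
      (\<forall>B\<in>sets (base F). emeasure Q B = (\<Sum>i=1..t. ennreal (q i) * emeasure (component F (\<theta> i)) B)))"

text \<open>The observations are \<open>X 1, X 2, \<dots>\<close>; \<open>X 0\<close> is not used.\<close>

definition iid_mixture ::
    "'w measure \<Rightarrow> nat \<Rightarrow> ('p, 'x) family \<Rightarrow> (nat \<Rightarrow> 'w \<Rightarrow> 'x) \<Rightarrow> bool" where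
  "iid_mixture M t F X \<longleftrightarrow>
    prob_space M \<and>
    prob_space.indep_vars M (\<lambda>_. base F) X {1..} \<and>
    (\<exists>Q. mixture_with t F Q \<and> (\<forall>j\<ge>1. distr M (base F) (X j) = Q))"


section \<open>Exponential families in canonical form and conjugate priors\<close>

definition natural_params :: "'x measure \<Rightarrow> ('x \<Rightarrow> 'p::euclidean_space) \<Rightarrow> 'p set" where
  "natural_params L s = {\<theta>. (\<integral>\<^sup>+x. ennreal (exp (\<theta> \<bullet> s x)) \<partial>L) < \<infinity>}"

definition log_partition :: "'x measure \<Rightarrow> ('x \<Rightarrow> 'p::euclidean_space) \<Rightarrow> 'p \<Rightarrow> real" where
  "log_partition L s \<theta> = ln (\<integral>x. exp (\<theta> \<bullet> s x) \<partial>L)"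

definition exp_family :: "'x measure \<Rightarrow> ('x \<Rightarrow> 'p::euclidean_space) \<Rightarrow> ('p, 'x) family" where
  "exp_family L s =
    \<lparr>base = L, param_space = natural_params L s,
     dens = (\<lambda>\<theta> x. exp (\<theta> \<bullet> s x - log_partition L s \<theta>))\<rparr>"

definition mean_params :: "'x measure \<Rightarrow> ('x \<Rightarrow> 'p::euclidean_space) \<Rightarrow> 'p set" where
  "mean_params L s = (\<lambda>\<theta>. \<integral>x. s x \<partial>component (exp_family L s) \<theta>) ` natural_params L s"

definition conj_params :: "'x measure \<Rightarrow> ('x \<Rightarrow> 'p::euclidean_space) \<Rightarrow> ('p \<times> real) set" where
  "conj_params L s = {(\<xi>, \<nu>). \<nu> > 0 \<and> \<xi> /\<^sub>R \<nu> \<in> mean_params L s}"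

definition log_conj_norm ::
    "'x measure \<Rightarrow> ('x \<Rightarrow> 'p::euclidean_space) \<Rightarrow> 'p \<Rightarrow> real \<Rightarrow> real" where
  "log_conj_norm L s \<xi> \<nu> =
    ln (LINT \<theta>:natural_params L s|lborel. exp (\<xi> \<bullet> \<theta> - \<nu> * log_partition L s \<theta>))"

definition conj_prior ::
    "'x measure \<Rightarrow> ('x \<Rightarrow> 'p::euclidean_space) \<Rightarrow> 'p \<Rightarrow> real \<Rightarrow> 'p \<Rightarrow> real" where
  "conj_prior L s \<xi> \<nu> \<theta> =
    exp (\<xi> \<bullet> \<theta> - \<nu> * log_partition L s \<theta> - log_conj_norm L s \<xi> \<nu>) *
    indicator (natural_params L s) \<theta>"


section \<open>The concrete families\<close>

text \<open>The pairs \<open>(i, j)\<close> with \<open>i \<le> j\<close> are encoded as unordered pairs (with repetition) of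
  coordinates, so the parameter space for the \<open>d\<close>-dimensional normal family is
  \<open>real^'d \<times> real^('d uprod)\<close>, of dimension \<open>d + d(d+1)/2\<close>.  The natural parameters are
  exactly those with negative definite quadratic part, so the mean and the covariance
  matrix are unrestricted.\<close>

instance uprod :: (finite) finite
  by standard simp

lift_definition quad_monomial :: "real^'d \<Rightarrow> 'd uprod \<Rightarrow> real"
  is "\<lambda>x (i, j). x $ i * x $ j"
  by (auto simp: mult.commute)

definition normal_stat :: "real^'d \<Rightarrow> (real^'d) \<times> (real^('d uprod))" where
  "normal_stat x = (x, \<chi> u. quad_monomial x u)"

definition pos_lborel :: "real measure" where
  "pos_lborel = restrict_space lborel {0<..}"

definition gamma_stat :: "real \<Rightarrow> real \<times> real" where
  "gamma_stat x = (ln x, x)"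

definition lognormal_stat :: "real \<Rightarrow> real \<times> real" where
  "lognormal_stat x = (ln x, (ln x)\<^sup>2)"

definition weibull_base :: "real \<Rightarrow> real measure" where
  "weibull_base a = density pos_lborel (\<lambda>x. ennreal (x powr (a - 1)))"

definition weibull_stat :: "real \<Rightarrow> real \<Rightarrow> real" where
  "weibull_stat a x = x powr a"

definition discrete_family ::
    "('p::euclidean_space, 'x::euclidean_space) family \<Rightarrow> bool" where
  "discrete_family F \<longleftrightarrow>
    component_family F \<and> countable (space (base F)) \<and>
    base F = count_space (space (base F))"

end

theory Submission
  imports Defs "HOL-Real_Asymp.Real_Asymp"
begin

text \<open>Moving one observation \<open>j\<close> of a partition into a part of its own changes the prior weight by a factor of
  order \<open>1 / n\<close>.  If for every partition into \<open>t\<close> parts a positive fraction of the \<open>n\<close> observations can be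
  split off from their part \<open>J\<close> at bounded cost, \<open>m(x\<^sub>J) \<le> c m(x\<^bsub>J - j\<^esub>) m(x\<^sub>j)\<close>, then summing over \<open>j\<close>
  gives \<open>p(x, T = t) \<le> C p(x, T = t + 1)\<close> with \<open>C\<close> independent of \<open>n\<close>, and the posterior of \<open>t\<close> stays
  below \<open>C / (1 + C)\<close>.

  In the discrete case the observations equal to a common atom can be split off, because probabilities are at
  most 1.  In the other families the densities are quasi-concave.  If finitely many observations of \<open>J\<close> have a
  convex hull of measure at least \<open>V\<close>, then for every \<open>\<theta>\<close> one of them has density at most \<open>1 / V\<close>, so that
  \<open>V m(x\<^sub>J) \<le> \<Sum> m(x\<^bsub>J - j\<^esub>)\<close>, the sum extending over these observations.  Hence the observations
  that are expensive to split off have no fat hull: they lie in a thin slab, and by the law of large numbers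
  and compactness of the set of slabs they are few.  No asymptotics of the marginals are needed.\<close>

section \<open>Splitting an observation off its part\<close>

text \<open>The loss of order 1/n is the ratio w_n(a) / w_n(a - 1) = a - 1 - \<sigma>, at most (1 +
  |\<sigma>|) n; the ratio of v_n(t + 1) to v_n(t), (\<theta>0 + t \<sigma>) / (t + 1), does not
  depend on n. Counting makes up for the loss: each partition has at least \<epsilon> n cheap
  splittings, and a partition into t + 1 parts arises in at most t ways. For admissible parameters
  the second ratio vanishes exactly at the excluded t = N; beyond N already v_n(t) is zero. The
  obstacle is uniformity: the cost c must not depend on n, on the partition or on the region where
  \<theta> lies. Hence density bounds are taken pointwise in \<theta> and then integrated, the
  number of hull points is bounded by means of a finite net of a compact set, and observations
  outside that set or with small m(x_j) are given up as a small fraction of the data.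
  Quasi-concavity and not log-concavity is the right condition: gamma and Weibull densities with
  shape below 1 and log-normal densities, taken with respect to their base measures, are not
  log-concave.\<close>

lemma finite_ordered_partitions: "finite (ordered_partitions t n)"
proof (rule finite_subset)
  show "ordered_partitions t n \<subseteq> {xs. set xs \<subseteq> Pow {1..n} \<and> length xs = t}"
    by (fastforce simp: ordered_partitions_def in_set_conv_nth)
  show "finite {xs. set xs \<subseteq> Pow {1..n} \<and> length xs = t}"
    by (rule finite_lists_length_eq) simp
qed

text \<open>The singleton goes to the end and all other parts keep their positions: the last entry
  then returns \<open>j\<close>, and only \<open>l\<close> has to be remembered to undo the
  splitting.\<close>

definition split_off :: "nat set list \<Rightarrow> nat \<Rightarrow> nat \<Rightarrow> nat set list" where
  "split_off A l j = A[l := A ! l - {j}] @ [{j}]"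

lemma split_off_nth:
  assumes "l < length A"
  shows "i < length A \<Longrightarrow> split_off A l j ! i = (if i = l then A ! l - {j} else A ! i)"
    and "split_off A l j ! length A = {j}"
  using assms by (auto simp: split_off_def nth_append)

lemma split_off_ordered_partitions:
  assumes A: "A \<in> ordered_partitions t n" and l: "l < t" and j: "j \<in> A ! l"
    and two: "card (A ! l) \<ge> 2"
  shows "split_off A l j \<in> ordered_partitions (Suc t) n"
proof -
  have len: "length A = t" and ne: "\<And>i. i < t \<Longrightarrow> A ! i \<noteq> {}"
    and dj: "\<And>i k. i < t \<Longrightarrow> k < t \<Longrightarrow> i \<noteq> k \<Longrightarrow> A ! i \<inter> A ! k = {}"
    and un: "(\<Union>i<t. A ! i) = {1..n}"
    using A by (auto simp: ordered_partitions_def)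
  have lt: "l < length A" using l len by simp
  note nth = split_off_nth[OF lt, unfolded len]
  have "A ! l \<noteq> {j}" using two by auto
  hence ne': "A ! l - {j} \<noteq> {}" using j by auto
  have 1: "length (split_off A l j) = Suc t" using len by (simp add: split_off_def)
  have 2: "split_off A l j ! i \<noteq> {}" if "i < Suc t" for i
    using that ne ne' nth by (cases "i = t") auto
  have 3: "split_off A l j ! i \<inter> split_off A l j ! k = {}" if "i < Suc t" "k < Suc t" "i \<noteq> k" for i k
  proof -
    have *: "split_off A l j ! i \<inter> split_off A l j ! t = {}" if "i < t" for i
      using that nth(1)[OF that, of j] nth(2)[of j] dj[of i l] l j by (auto split: if_splits)
    have **: "split_off A l j ! i \<inter> split_off A l j ! k = {}" if "i < t" "k < t" "i \<noteq> k" for i k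
      using that nth(1)[OF that(1), of j] nth(1)[OF that(2), of j] dj[of i k] l j by (auto split: if_splits)
    consider "i = t" "k < t" | "k = t" "i < t" | "i < t" "k < t" using \<open>i < Suc t\<close> \<open>k < Suc t\<close> \<open>i \<noteq> k\<close>
      by linarith
    thus ?thesis
    proof cases
      case 1 thus ?thesis using *[of k] by (simp add: Int_commute)
    next
      case 2 thus ?thesis using *[of i] by simp
    next
      case 3 thus ?thesis using **[of i k] \<open>i \<noteq> k\<close> by simp
    qed
  qed
  have "(\<Union>i<Suc t. split_off A l j ! i) = (\<Union>i<t. split_off A l j ! i) \<union> {j}"
    using nth(2) by (simp add: lessThan_Suc Un_commute)
  also have "(\<Union>i<t. split_off A l j ! i) = (\<Union>i<t. if i = l then A ! l - {j} else A ! i)"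
    using nth(1) by (intro SUP_cong) auto
  also have "\<dots> \<union> {j} = (\<Union>i<t. A ! i)"
    using l j by (fastforce split: if_splits)
  finally show ?thesis
    unfolding ordered_partitions_def using 1 2 3 un by simp
qed

text \<open>Double counting: a partition into \<open>t + 1\<close> parts, together with the position \<open>l\<close> of the part
  that lost a point, determines the partition it came from.\<close>

lemma sum_split_off_le:
  fixes f :: "nat set list \<Rightarrow> real"
  assumes f: "\<And>B. f B \<ge> 0" and D: "D \<ge> 0" and n: "n > 0"
    and many: "\<And>A. A \<in> ordered_partitions t n \<Longrightarrow>
      \<epsilon> * real n \<le> card {j. \<exists>l<t. j \<in> A ! l \<and> card (A ! l) \<ge> 2 \<and> f A \<le> D * real n * f (split_off A l j)}"
  shows "\<epsilon> * sum f (ordered_partitions t n) \<le> real t * D * sum f (ordered_partitions (Suc t) n)"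
proof -
  define G where "G A = {(l, j). l < t \<and> j \<in> A ! l \<and> card (A ! l) \<ge> 2 \<and> f A \<le> D * real n * f (split_off A l j)}" for A
  let ?P = "ordered_partitions t n" and ?P' = "ordered_partitions (Suc t) n"
  have finG: "finite (G A)" if "A \<in> ?P" for A
  proof (rule finite_subset)
    show "G A \<subseteq> {..<t} \<times> {1..n}" using that by (fastforce simp: G_def ordered_partitions_def)
  qed auto
  \<comment> \<open>\<open>many\<close> counts points, \<open>G A\<close> counts pairs of a position
    and a point; projecting to points can only lose elements, so the lower bound carries
    over.\<close>
  have cardG: "\<epsilon> * real n \<le> card (G A)" if "A \<in> ?P" for A
  proof -
    have "{j. \<exists>l<t. j \<in> A ! l \<and> card (A ! l) \<ge> 2 \<and> f A \<le> D * real n * f (split_off A l j)} = snd ` G A"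
      by (force simp: G_def)
    hence "\<epsilon> * real n \<le> card (snd ` G A)" using many[OF that] by simp
    also have "\<dots> \<le> card (G A)" using card_image_le[OF finG[OF that]] by simp
    finally show ?thesis .
  qed
  define S where "S = Sigma ?P G"
  define \<phi> where "\<phi> = (\<lambda>(A, l, j). (split_off A l j, l :: nat))"
  have finS: "finite S" unfolding S_def using finG finite_ordered_partitions by blast
  have inj: "inj_on \<phi> S"
  proof (rule inj_onI)
    fix p q assume p: "p \<in> S" and q: "q \<in> S" and eq: "\<phi> p = \<phi> q"
    obtain A l j where p': "p = (A, l, j)" by (cases p)
    obtain B k i where q': "q = (B, k, i)" by (cases q)
    have A: "length A = t" "l < t" "j \<in> A ! l" and B: "length B = t" "k < t" "i \<in> B ! k"
      using p q by (auto simp: p' q' S_def G_def ordered_partitions_def)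
    have k: "k = l" and s: "split_off A l j = split_off B l i" using eq by (auto simp: \<phi>_def p' q')
    have ij: "i = j" and u: "A[l := A ! l - {j}] = B[l := B ! l - {i}]" using s by (auto simp: split_off_def)
    have "A ! l - {j} = B ! l - {j}"
      using arg_cong[OF u, of "\<lambda>xs. xs ! l"] A B ij by simp
    hence l: "A ! l = B ! l" using A B k ij by auto
    have "A = B"
    proof (rule nth_equalityI)
      fix m assume "m < length A"
      thus "A ! m = B ! m" using arg_cong[OF u, of "\<lambda>xs. xs ! m"] l A B by (cases "m = l") auto
    qed (use A B in simp)
    thus "p = q" using p' q' k ij by simp
  qed
  have img: "\<phi> ` S \<subseteq> ?P' \<times> {..<t}"
    by (auto simp: \<phi>_def S_def G_def intro!: split_off_ordered_partitions)
  have "\<epsilon> * real n * sum f ?P = (\<Sum>A\<in>?P. \<epsilon> * real n * f A)" by (simp add: sum_distrib_left)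
  also have "\<dots> \<le> (\<Sum>A\<in>?P. \<Sum>_\<in>G A. f A)"
    using cardG f by (intro sum_mono) (simp add: mult_right_mono)
  also have "\<dots> = (\<Sum>(A, p)\<in>S. f A)"
    unfolding S_def using finG by (intro sum.Sigma) (auto simp: finite_ordered_partitions)
  also have "\<dots> \<le> (\<Sum>p\<in>S. D * real n * f (fst (\<phi> p)))"
    by (intro sum_mono) (auto simp: S_def G_def \<phi>_def)
  also have "\<dots> = D * real n * (\<Sum>p\<in>\<phi> ` S. f (fst p))"
    by (simp add: sum.reindex[OF inj] sum_distrib_left)
  also have "\<dots> \<le> D * real n * (\<Sum>p\<in>?P' \<times> {..<t}. f (fst p))"
    using img f D by (intro mult_left_mono sum_mono2) (auto simp: finite_ordered_partitions)
  also have "(\<Sum>p\<in>?P' \<times> {..<t}. f (fst p)) = (\<Sum>B\<in>?P'. \<Sum>_<t. f B)"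
    by (subst sum.cartesian_product) (simp add: case_prod_unfold)
  also have "\<dots> = real t * sum f ?P'" by (simp add: sum_distrib_left)
  \<comment> \<open>The \<open>n\<close> from the number of splittings per partition cancels the
    \<open>n\<close> lost with each splitting.\<close>
  finally have "real n * (\<epsilon> * sum f ?P) \<le> real n * (real t * D * sum f ?P')" by (simp only: mult_ac)
  thus ?thesis by (rule mult_left_le_imp_le) (use n in simp)
qed

section \<open>Pitman-Yor weights and their change under a splitting\<close>

lemma py_params_bounds: "py_params \<sigma> \<theta>\<^sub>0 \<Longrightarrow> \<sigma> < 1 \<and> \<theta>\<^sub>0 > -1 \<and> \<theta>\<^sub>0 + \<sigma> \<ge> 0"
proof (cases "\<sigma> < 0")
  case True
  assume "py_params \<sigma> \<theta>\<^sub>0"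
  with True obtain N :: nat where N: "N \<ge> 1" "\<theta>\<^sub>0 = real N * \<bar>\<sigma>\<bar>" by (auto simp: py_params_def)
  hence "\<theta>\<^sub>0 \<ge> 1 * \<bar>\<sigma>\<bar>" unfolding N(2) by (intro mult_right_mono) auto
  thus ?thesis using True by auto
qed (auto simp: py_params_def)

lemma py_w_pos: "\<sigma> < 1 \<Longrightarrow> py_w \<sigma> a > 0"
  unfolding py_w_def rising_def by (intro prod_pos) auto

text \<open>This peels off the last factor of the rising factorial. For \<open>a = 1\<close>
  truncated subtraction gives \<open>py_w \<sigma> 0 = py_w \<sigma> 1 = 1\<close>, and the identity
  would read 1 = -\<sigma>.\<close>

lemma py_w_Suc:
  assumes "a \<ge> 2" shows "py_w \<sigma> a = (real a - 1 - \<sigma>) * py_w \<sigma> (a - 1)"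
proof -
  define b where "b = a - 2"
  have b: "a - 1 = Suc b" "a - 1 - 1 = b" "real a = real b + 2" using assms by (auto simp: b_def)
  show ?thesis unfolding py_w_def b rising_def by (simp add: algebra_simps)
qed

lemma rising_concentration_pos:
  assumes "py_params \<sigma> \<theta>\<^sub>0" shows "rising (\<theta>\<^sub>0 + 1) 1 k > 0"
  using py_params_bounds[OF assms] unfolding rising_def by (intro prod_pos) auto

text \<open>For negative \<sigma> the factors are (N - 1 - i) |\<sigma>|. They pass through an exact
  zero at i = N - 1, so a product long enough to contain negative factors also contains that
  zero.\<close>

lemma rising_discount_nonneg:
  assumes "py_params \<sigma> \<theta>\<^sub>0" shows "rising (\<theta>\<^sub>0 + \<sigma>) \<sigma> k \<ge> 0"
proof (cases "\<sigma> < 0")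
  case False
  thus ?thesis using py_params_bounds[OF assms] unfolding rising_def by (intro prod_nonneg) auto
next
  case True
  then obtain N :: nat where N: "N \<ge> 1" "\<theta>\<^sub>0 = real N * \<bar>\<sigma>\<bar>" using assms by (auto simp: py_params_def)
  have eq: "\<theta>\<^sub>0 + \<sigma> + real i * \<sigma> = (real N - 1 - real i) * \<bar>\<sigma>\<bar>" for i
    using True N by (simp add: algebra_simps)
  show ?thesis
  proof (cases "k \<ge> N")
    case True
    hence "\<exists>i<k. \<theta>\<^sub>0 + \<sigma> + real i * \<sigma> = 0" unfolding eq using N
      by (intro exI[of _ "N - 1"]) (auto simp: of_nat_diff)
    thus ?thesis unfolding rising_def by (subst prod_zero) auto
  next
    case False
    thus ?thesis unfolding rising_def eq by (intro prod_nonneg) auto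
  qed
qed

lemma py_v_nonneg: "py_params \<sigma> \<theta>\<^sub>0 \<Longrightarrow> py_v \<sigma> \<theta>\<^sub>0 n t \<ge> 0"
  unfolding py_v_def using rising_discount_nonneg rising_concentration_pos by (simp add: less_imp_le)

lemma py_v_Suc:
  assumes "t \<ge> 1"
  shows "py_v \<sigma> \<theta>\<^sub>0 n (Suc t) * (real t + 1) = py_v \<sigma> \<theta>\<^sub>0 n t * (\<theta>\<^sub>0 + real t * \<sigma>)"
proof -
  have "rising (\<theta>\<^sub>0 + \<sigma>) \<sigma> t = rising (\<theta>\<^sub>0 + \<sigma>) \<sigma> (t - 1) * (\<theta>\<^sub>0 + real t * \<sigma>)"
    using assms by (cases t) (auto simp: rising_def algebra_simps)
  moreover have "fact (Suc t) = (real t + 1) * (fact t :: real)" by simp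
  moreover have "(r * c) / (d * ((real t + 1) * k)) * (real t + 1) = r / (d * k) * c" for r c d k :: real
    by simp
  ultimately show ?thesis unfolding py_v_def diff_Suc_1 by (simp only:)
qed

text \<open>The excluded case t = N enters here: for it \<theta>0 + t \<sigma> is zero and all
  weights of partitions into t + 1 parts vanish, while those for t parts do not. For t > N the
  product in \<open>py_v\<close> contains a zero factor.\<close>

lemma py_v_dichotomy:
  assumes py: "py_params \<sigma> \<theta>\<^sub>0" and t: "t \<ge> 1" and N: "\<not> (\<sigma> < 0 \<and> \<theta>\<^sub>0 = real t * \<bar>\<sigma>\<bar>)"
  shows "\<theta>\<^sub>0 + real t * \<sigma> > 0 \<or> (\<forall>n. py_v \<sigma> \<theta>\<^sub>0 n t = 0)"
proof (cases "\<sigma> < 0")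
  case False
  hence "real t * \<sigma> \<ge> 1 * \<sigma>" using t by (intro mult_right_mono) auto
  thus ?thesis using False py by (auto simp: py_params_def)
next
  case True
  then obtain K :: nat where K: "K \<ge> 1" "\<theta>\<^sub>0 = real K * \<bar>\<sigma>\<bar>" using py by (auto simp: py_params_def)
  hence "K \<noteq> t" using N True by auto
  show ?thesis
  proof (cases "K < t")
    case True
    have "\<theta>\<^sub>0 + \<sigma> + real (K - 1) * \<sigma> = 0" using \<open>\<sigma> < 0\<close> K by (simp add: of_nat_diff algebra_simps)
    hence "\<exists>i<t - 1. \<theta>\<^sub>0 + \<sigma> + real i * \<sigma> = 0" using True K by (intro exI[of _ "K - 1"]) auto
    hence "rising (\<theta>\<^sub>0 + \<sigma>) \<sigma> (t - 1) = 0" unfolding rising_def by (intro prod_zero) auto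
    thus ?thesis by (simp add: py_v_def)
  next
    case False
    hence "K > t" using \<open>K \<noteq> t\<close> by simp
    moreover have "\<theta>\<^sub>0 + real t * \<sigma> = (real K - real t) * \<bar>\<sigma>\<bar>" using \<open>\<sigma> < 0\<close> K by (simp add: algebra_simps)
    moreover have "(real K - real t) * \<bar>\<sigma>\<bar> > 0" using \<open>K > t\<close> \<open>\<sigma> < 0\<close> by (intro mult_pos_pos) auto
    ultimately show ?thesis using \<open>\<sigma> < 0\<close> by simp
  qed
qed

text \<open>The cost has three sources: \<open>c\<close> from the set function \<open>mu\<close>, (1
  + |\<sigma>|) n from the weights \<open>py_w\<close>, and the last fraction from the weights
  \<open>py_v\<close>. All parts other than \<open>A ! l\<close> contribute the common factor
  \<open>R\<close>.\<close>

lemma py_weight_split_off: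
  fixes mu :: "nat set \<Rightarrow> real"
  assumes py: "py_params \<sigma> \<theta>\<^sub>0" and t: "t \<ge> 1" and pos: "\<theta>\<^sub>0 + real t * \<sigma> > 0" and n: "n \<ge> 1"
    and mu: "\<And>J. mu J \<ge> 0" and c: "c \<ge> 0"
    and A: "A \<in> ordered_partitions t n" and l: "l < t" and j: "j \<in> A ! l" and two: "card (A ! l) \<ge> 2"
    and le: "mu (A ! l) \<le> c * mu (A ! l - {j}) * mu {j}"
  defines "f \<equiv> \<lambda>A. py_prior \<sigma> \<theta>\<^sub>0 n A * (\<Prod>i<length A. mu (A ! i))"
  shows "f A \<le> c * (1 + \<bar>\<sigma>\<bar>) * ((real t + 1) / (\<theta>\<^sub>0 + real t * \<sigma>)) * real n * f (split_off A l j)"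
proof -
  define h where "h J = py_w \<sigma> (card J) * mu J" for J
  have sig: "\<sigma> < 1" using py_params_bounds[OF py] by simp
  have h0: "h J \<ge> 0" for J using py_w_pos[OF sig] mu by (simp add: h_def less_imp_le)
  have f: "f A = py_v \<sigma> \<theta>\<^sub>0 n (length A) * (\<Prod>i<length A. h (A ! i))" for A
    by (simp add: f_def py_prior_def h_def prod.distrib)
  have len: "length A = t" and un: "(\<Union>i<t. A ! i) = {1..n}" using A by (auto simp: ordered_partitions_def)
  have sub: "A ! l \<subseteq> {1..n}" using un l by blast
  have fin: "finite (A ! l)" using sub finite_subset by blast
  have cn: "card (A ! l) \<le> n" using card_mono[OF _ sub] by simp
  have lt: "l < length A" using l len by simp
  define R where "R = (\<Prod>i\<in>{..<t} - {l}. h (A ! i))"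
  have R0: "R \<ge> 0" unfolding R_def by (intro prod_nonneg) (simp add: h0)
  have pA: "(\<Prod>i<t. h (A ! i)) = h (A ! l) * R"
    unfolding R_def using l by (subst prod.remove[of _ l]) auto
  have "(\<Prod>i<Suc t. h (split_off A l j ! i)) = (\<Prod>i<t. h (split_off A l j ! i)) * h {j}"
    using split_off_nth(2)[OF lt, of j] len by simp
  also have "(\<Prod>i<t. h (split_off A l j ! i)) = (\<Prod>i<t. h (if i = l then A ! l - {j} else A ! i))"
    using split_off_nth(1)[OF lt] len by (intro prod.cong) auto
  also have "\<dots> = h (A ! l - {j}) * R"
    unfolding R_def using l by (subst prod.remove[of _ l]) auto
  finally have pB: "(\<Prod>i<Suc t. h (split_off A l j ! i)) = h (A ! l - {j}) * R * h {j}" .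
  have lenB: "length (split_off A l j) = Suc t" using len by (simp add: split_off_def)
  have v: "py_v \<sigma> \<theta>\<^sub>0 n t = (real t + 1) / (\<theta>\<^sub>0 + real t * \<sigma>) * py_v \<sigma> \<theta>\<^sub>0 n (Suc t)"
    using py_v_Suc[OF t, of \<sigma> \<theta>\<^sub>0 n] pos by (simp add: field_simps)
  have w1: "py_w \<sigma> (card {j}) = 1" by (simp add: py_w_def rising_def)
  have wa: "py_w \<sigma> (card (A ! l)) = (real (card (A ! l)) - 1 - \<sigma>) * py_w \<sigma> (card (A ! l - {j}))"
    using py_w_Suc[OF two] j fin by simp
  have "real (card (A ! l)) - 1 - \<sigma> \<le> real n * 1 + 1 * \<bar>\<sigma>\<bar>" using cn by linarith
  also have "\<dots> \<le> real n * 1 + real n * \<bar>\<sigma>\<bar>" using n by (intro add_mono mult_right_mono) auto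
  finally have "real (card (A ! l)) - 1 - \<sigma> \<le> (1 + \<bar>\<sigma>\<bar>) * real n" by (simp add: algebra_simps)
  hence "py_w \<sigma> (card (A ! l)) \<le> (1 + \<bar>\<sigma>\<bar>) * real n * py_w \<sigma> (card (A ! l - {j}))"
    unfolding wa using py_w_pos[OF sig] by (intro mult_right_mono) (auto simp: less_imp_le)
  hence "h (A ! l) \<le> ((1 + \<bar>\<sigma>\<bar>) * real n * py_w \<sigma> (card (A ! l - {j}))) * (c * mu (A ! l - {j}) * mu {j})"
    unfolding h_def using le mu py_w_pos[OF sig]
    by (intro mult_mono) (auto simp: less_imp_le intro!: mult_nonneg_nonneg)
  also have "\<dots> = c * (1 + \<bar>\<sigma>\<bar>) * real n * (h (A ! l - {j}) * h {j})"
    by (simp add: h_def w1[simplified])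
  finally have hl: "h (A ! l) \<le> c * (1 + \<bar>\<sigma>\<bar>) * real n * (h (A ! l - {j}) * h {j})" .
  have "f A = py_v \<sigma> \<theta>\<^sub>0 n t * (h (A ! l) * R)" by (simp add: f len pA)
  also have "\<dots> \<le> py_v \<sigma> \<theta>\<^sub>0 n t * ((c * (1 + \<bar>\<sigma>\<bar>) * real n * (h (A ! l - {j}) * h {j})) * R)"
    by (intro mult_left_mono mult_right_mono hl R0 py_v_nonneg py)
  also have "\<dots> = c * (1 + \<bar>\<sigma>\<bar>) * ((real t + 1) / (\<theta>\<^sub>0 + real t * \<sigma>)) * real n *
      (py_v \<sigma> \<theta>\<^sub>0 n (Suc t) * (h (A ! l - {j}) * R * h {j}))"
    unfolding v by (simp only: mult_ac)
  also have "py_v \<sigma> \<theta>\<^sub>0 n (Suc t) * (h (A ! l - {j}) * R * h {j}) = f (split_off A l j)"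
    unfolding f lenB pB ..
  finally show ?thesis .
qed

section \<open>From joint weights to the posterior\<close>

lemma joint_nonneg: "py_params \<sigma> \<theta>\<^sub>0 \<Longrightarrow> joint \<sigma> \<theta>\<^sub>0 F \<pi> n x t \<ge> 0"
  unfolding joint_def py_prior_def
  using py_v_nonneg[of \<sigma> \<theta>\<^sub>0] py_w_pos[of \<sigma>] py_params_bounds[of \<sigma> \<theta>\<^sub>0]
  by (intro sum_nonneg mult_nonneg_nonneg prod_nonneg) (auto simp: less_imp_le)

lemma joint_le_joint_Suc:
  assumes py: "py_params \<sigma> \<theta>\<^sub>0" and t: "t \<ge> 1" and pos: "\<theta>\<^sub>0 + real t * \<sigma> > 0" and n: "n \<ge> 1" and c: "c \<ge> 0"
    and many: "\<And>A. A \<in> ordered_partitions t n \<Longrightarrow>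
      \<epsilon> * real n \<le> card {j. \<exists>l<t. j \<in> A ! l \<and> card (A ! l) \<ge> 2 \<and> enn2real (marginal F \<pi> x (A ! l)) \<le>
        c * enn2real (marginal F \<pi> x (A ! l - {j})) * enn2real (marginal F \<pi> x {j})}"
  shows "\<epsilon> * joint \<sigma> \<theta>\<^sub>0 F \<pi> n x t \<le>
    real t * (c * (1 + \<bar>\<sigma>\<bar>) * ((real t + 1) / (\<theta>\<^sub>0 + real t * \<sigma>))) * joint \<sigma> \<theta>\<^sub>0 F \<pi> n x (Suc t)"
proof -
  define mu where "mu J = enn2real (marginal F \<pi> x J)" for J
  \<comment> \<open>Writing \<open>length A\<close> for the number of parts makes \<open>f\<close> a
    single function on partitions into \<open>t\<close> and into \<open>t + 1\<close> parts, as the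
    double counting requires.\<close>
  define f where "f A = py_prior \<sigma> \<theta>\<^sub>0 n A * (\<Prod>i<length A. mu (A ! i))" for A
  have joint: "joint \<sigma> \<theta>\<^sub>0 F \<pi> n x s = sum f (ordered_partitions s n)" for s
    unfolding joint_def f_def mu_def by (intro sum.cong) (auto simp: ordered_partitions_def)
  have f0: "f A \<ge> 0" for A
    unfolding f_def py_prior_def mu_def
    using py_v_nonneg[OF py] py_w_pos[of \<sigma>] py_params_bounds[OF py]
    by (intro mult_nonneg_nonneg prod_nonneg) (auto simp: less_imp_le)
  define D where "D = c * (1 + \<bar>\<sigma>\<bar>) * ((real t + 1) / (\<theta>\<^sub>0 + real t * \<sigma>))"
  have D0: "D \<ge> 0" unfolding D_def using c pos by (intro mult_nonneg_nonneg divide_nonneg_nonneg) auto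
  show ?thesis
    unfolding joint D_def[symmetric]
  proof (rule sum_split_off_le[OF f0 D0])
    fix A assume A: "A \<in> ordered_partitions t n"
    let ?J = "{j. \<exists>l<t. j \<in> A ! l \<and> card (A ! l) \<ge> 2 \<and> mu (A ! l) \<le> c * mu (A ! l - {j}) * mu {j}}"
    let ?K = "{j. \<exists>l<t. j \<in> A ! l \<and> card (A ! l) \<ge> 2 \<and> f A \<le> D * real n * f (split_off A l j)}"
    have "?K \<subseteq> {1..n}" using A by (auto simp: ordered_partitions_def)
    hence finK: "finite ?K" using finite_subset by blast
    have "?J \<subseteq> ?K"
      using py_weight_split_off[OF py t pos n _ c A, of mu] unfolding f_def D_def by (auto simp: mu_def)
    hence "card ?J \<le> card ?K" using finK by (rule card_mono[rotated])
    thus "\<epsilon> * real n \<le> card ?K" using many[OF A] by (simp add: mu_def)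
  qed (use n in simp)
qed

lemma limsup_less_oneI:
  fixes a :: "nat \<Rightarrow> real"
  assumes "q < 1" "eventually (\<lambda>n. a n \<le> q) sequentially"
  shows "limsup (\<lambda>n. ereal (a n)) < 1"
proof -
  have "limsup (\<lambda>n. ereal (a n)) \<le> ereal q"
    using assms(2) by (intro Limsup_bounded) simp
  also have "\<dots> < 1" using assms(1) by simp
  finally show ?thesis .
qed

text \<open>If x \<le> C y then x / (x + y) \<le> C / (1 + C). The count in \<open>many\<close>
  includes singleton parts, which cannot be split; they hold at most \<open>t\<close> observations,
  so for large \<open>n\<close> half of \<open>\<epsilon>\<close> survives.\<close>

lemma posterior_limsup_less_one:
  assumes py: "py_params \<sigma> \<theta>\<^sub>0" and t: "t \<ge> 1" and N: "\<not> (\<sigma> < 0 \<and> \<theta>\<^sub>0 = real t * \<bar>\<sigma>\<bar>)"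
    and c: "c \<ge> 0" and eps: "\<epsilon> > 0"
    and many: "eventually (\<lambda>n. \<forall>A\<in>ordered_partitions t n.
      \<epsilon> * real n \<le> card {j. \<exists>l<t. j \<in> A ! l \<and> enn2real (marginal F \<pi> x (A ! l)) \<le>
        c * enn2real (marginal F \<pi> x (A ! l - {j})) * enn2real (marginal F \<pi> x {j})}) sequentially"
  shows "limsup (\<lambda>n. ereal (posterior \<sigma> \<theta>\<^sub>0 F \<pi> n x t)) < 1"
  using py_v_dichotomy[OF py t N]
proof
  assume "\<forall>n. py_v \<sigma> \<theta>\<^sub>0 n t = 0"
  hence "joint \<sigma> \<theta>\<^sub>0 F \<pi> n x t = 0" for n
    unfolding joint_def py_prior_def by (intro sum.neutral) (auto simp: ordered_partitions_def)
  hence "posterior \<sigma> \<theta>\<^sub>0 F \<pi> n x t = 0" for n by (simp add: posterior_def Let_def)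
  thus ?thesis by (intro limsup_less_oneI[of 0]) auto
next
  assume pos: "\<theta>\<^sub>0 + real t * \<sigma> > 0"
  define mu where "mu J = enn2real (marginal F \<pi> x J)" for J
  define C where "C = real t * (c * (1 + \<bar>\<sigma>\<bar>) * ((real t + 1) / (\<theta>\<^sub>0 + real t * \<sigma>))) / (\<epsilon> / 2)"
  have C0: "C \<ge> 0" unfolding C_def using c pos eps by (intro mult_nonneg_nonneg divide_nonneg_nonneg) auto
  have large: "eventually (\<lambda>n. real t \<le> \<epsilon> / 2 * real n) sequentially"
    using eps by real_asymp
  show ?thesis
  proof (rule limsup_less_oneI[of "C / (1 + C)"])
    show "C / (1 + C) < 1" using C0 by (simp add: field_simps)
    show "eventually (\<lambda>n. posterior \<sigma> \<theta>\<^sub>0 F \<pi> n x t \<le> C / (1 + C)) sequentially"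
      using many large eventually_ge_at_top[of "Suc t"]
    proof eventually_elim
      case (elim n)
      have n: "n \<ge> 1" "Suc t \<le> n" using elim by auto
      let ?j = "joint \<sigma> \<theta>\<^sub>0 F \<pi> n x"
      have "\<epsilon> / 2 * real n \<le> card {j. \<exists>l<t. j \<in> A ! l \<and> card (A ! l) \<ge> 2 \<and>
          mu (A ! l) \<le> c * mu (A ! l - {j}) * mu {j}}" (is "_ \<le> real (card ?K)")
        if A: "A \<in> ordered_partitions t n" for A
      proof -
        let ?J = "{j. \<exists>l<t. j \<in> A ! l \<and> mu (A ! l) \<le> c * mu (A ! l - {j}) * mu {j}}"
        \<comment> \<open>One chosen element per part: this contains the only element of every
          singleton part and has at most \<open>t\<close> elements.\<close>
        let ?S = "(\<lambda>l. SOME j. j \<in> A ! l) ` {..<t}"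
        have sub: "A ! l \<subseteq> {1..n}" if "l < t" for l using A that by (auto simp: ordered_partitions_def)
        have "?K \<subseteq> {1..n}" using sub by blast
        hence fin: "finite ?K" using finite_subset by blast
        have "?J \<subseteq> ?K \<union> ?S"
        proof
          fix j assume "j \<in> ?J"
          then obtain l where l: "l < t" "j \<in> A ! l" "mu (A ! l) \<le> c * mu (A ! l - {j}) * mu {j}" by auto
          have "finite (A ! l)" by (rule finite_subset[OF sub[OF l(1)]]) simp
          hence "card (A ! l) \<noteq> 0" using l(2) by auto
          then consider "card (A ! l) \<ge> 2" | "card (A ! l) = 1" by linarith
          thus "j \<in> ?K \<union> ?S"
          proof cases
            case 2
            then obtain i where "A ! l = {i}" by (auto simp: card_1_singleton_iff)
            hence "j = (SOME j. j \<in> A ! l)" using l by simp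
            thus ?thesis using l by blast
          qed (use l in blast)
        qed
        hence "card ?J \<le> card (?K \<union> ?S)" using fin by (intro card_mono) auto
        also have "\<dots> \<le> card ?K + card ?S" by (rule card_Un_le)
        also have "card ?S \<le> t" using card_image_le[of "{..<t}"] by simp
        finally have "real (card ?J) \<le> real (card ?K) + real t" by linarith
        moreover have "\<epsilon> * real n \<le> real (card ?J)" using elim(1) A by (simp add: mu_def)
        ultimately show ?thesis using elim(2) by (simp add: algebra_simps)
      qed
      from joint_le_joint_Suc[OF py t pos n(1) c, of "\<epsilon> / 2" F \<pi> x, folded mu_def, OF this]
      have "?j t * (\<epsilon> / 2) \<le> C * ?j (Suc t) * (\<epsilon> / 2)" using eps by (simp add: C_def mult_ac)
      hence le: "?j t \<le> C * ?j (Suc t)" using eps by (subst (asm) mult_le_cancel_right) auto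
      have nn: "?j s \<ge> 0" for s by (rule joint_nonneg[OF py])
      define Z where "Z = (\<Sum>t'=1..n. ?j t')"
      have "?j t + ?j (Suc t) = (\<Sum>t'\<in>{t, Suc t}. ?j t')" by simp
      also have "\<dots> \<le> Z" unfolding Z_def using t n nn by (intro sum_mono2) auto
      finally have Z: "?j t + ?j (Suc t) \<le> Z" .
      have "(1 + C) * ?j t \<le> C * (?j t + ?j (Suc t))" using le by (simp add: algebra_simps)
      also have "\<dots> \<le> C * Z" using Z C0 by (intro mult_left_mono)
      finally have "(1 + C) * ?j t \<le> C * Z" .
      moreover have "Z \<ge> 0" using Z nn[of t] nn[of "Suc t"] by linarith
      ultimately have "Z \<noteq> 0 \<Longrightarrow> ?j t / Z \<le> C / (1 + C)" using C0 by (simp add: divide_simps mult_ac)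
      thus ?case using C0 by (simp add: posterior_def Let_def Z_def)
    qed
  qed
qed

lemma not_consistent_if_limsup_less_one:
  assumes "limsup (\<lambda>n. ereal (posterior \<sigma> \<theta>\<^sub>0 F \<pi> n x t)) < 1"
  shows "\<not> consistent_for \<sigma> \<theta>\<^sub>0 F \<pi> x t"
proof
  assume "consistent_for \<sigma> \<theta>\<^sub>0 F \<pi> x t"
  hence "(\<lambda>n. ereal (posterior \<sigma> \<theta>\<^sub>0 F \<pi> n x t)) \<longlonglongrightarrow> ereal 1"
    unfolding consistent_for_def by simp
  hence "limsup (\<lambda>n. ereal (posterior \<sigma> \<theta>\<^sub>0 F \<pi> n x t)) = 1"
    by (simp add: lim_imp_Limsup one_ereal_def)
  thus False using assms by simp
qed

section \<open>Empirical frequencies and marginals\<close>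

text \<open>Hoeffding's inequality bounds the probability of exceeding \<open>\<beta> n\<close> by a
  geometric sequence in \<open>n\<close>, and the Borel-Cantelli lemma applies. Only such upper
  bounds on frequencies are used later.\<close>

lemma (in prob_space) AE_eventually_card_le:
  fixes X :: "nat \<Rightarrow> 'a \<Rightarrow> 'b"
  assumes indep: "indep_vars (\<lambda>_. N) X {1..}" and distr: "\<And>j. j \<ge> 1 \<Longrightarrow> distr M N (X j) = Q"
    and E: "E \<in> sets N" and less: "measure Q E < \<beta>"
  shows "AE \<omega> in M. eventually (\<lambda>n. real (card {j\<in>{1..n}. X j \<omega> \<in> E}) \<le> \<beta> * real n) sequentially"
proof -
  define Y :: "nat \<Rightarrow> 'a \<Rightarrow> real" where "Y j \<omega> = indicator E (X j \<omega>)" for j \<omega>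
  define q where "q = measure Q E"
  define d where "d = \<beta> - q"
  have d: "d > 0" using less by (simp add: d_def q_def)
  have X [measurable]: "j \<ge> 1 \<Longrightarrow> X j \<in> measurable M N" for j using indep by (auto simp: indep_vars_def)
  have EY: "expectation (Y j) = q" if "j \<ge> 1" for j
  proof -
    have "expectation (Y j) = expectation (indicator (X j -` E \<inter> space M))"
      unfolding Y_def by (intro Bochner_Integration.integral_cong) (auto simp: indicator_def)
    also have "\<dots> = prob (X j -` E \<inter> space M)" by simp
    also have "\<dots> = measure (distr M N (X j)) E" using X[OF that] E by (simp add: measure_distr)
    finally show ?thesis using distr[OF that] by (simp add: q_def)
  qed
  have indepY: "indep_vars (\<lambda>_. borel) Y {1..n}" for n
  proof -
    have "indep_vars (\<lambda>_. N) X {1..n}" by (rule indep_vars_subset[OF indep]) auto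
    from indep_vars_compose2[OF this, of "\<lambda>_. indicator E" "\<lambda>_. borel"]
    show ?thesis unfolding Y_def using E by simp
  qed
  define A where "A n = {\<omega>\<in>space M. (\<Sum>j\<in>{1..n}. Y j \<omega>) \<ge> (\<Sum>j\<in>{1..n}. expectation (Y j)) + d * real n}" for n
  have Ym: "j \<ge> 1 \<Longrightarrow> Y j \<in> borel_measurable M" for j
    unfolding Y_def using E by measurable
  have A_sets [measurable]: "A n \<in> sets M" for n
  proof -
    have "(\<lambda>\<omega>. \<Sum>j\<in>{1..n}. Y j \<omega>) \<in> borel_measurable M" using Ym by (intro borel_measurable_sum) auto
    thus ?thesis unfolding A_def by measurable
  qed
  have bound: "prob (A n) \<le> exp (- 2 * d\<^sup>2) ^ n" if "n \<ge> 1" for n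
  proof -
    interpret H: Hoeffding_ineq M "{1..n}" Y "\<lambda>_. 0" "\<lambda>_. 1" "\<Sum>j\<in>{1..n}. expectation (Y j)"
      by unfold_locales (use indepY in \<open>auto simp: Y_def indicator_def\<close>)
    have "prob (A n) \<le> exp (- 2 * (d * real n)\<^sup>2 / (\<Sum>i\<in>{1..n}. (1 - 0)\<^sup>2))"
      unfolding A_def using d that by (intro H.Hoeffding_ineq_ge) auto
    also have "- 2 * (d * real n)\<^sup>2 / (\<Sum>i\<in>{1..n}. (1 - 0)\<^sup>2) = real n * (- 2 * d\<^sup>2)"
      using that by (simp add: power2_eq_square)
    also have "exp \<dots> = exp (- 2 * d\<^sup>2) ^ n" by (rule exp_of_nat_mult)
    finally show ?thesis .
  qed
  have "summable (\<lambda>n. exp (- 2 * d\<^sup>2) ^ n)" using d by (intro summable_geometric) auto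
  hence "summable (\<lambda>n. prob (A n))"
    by (rule summable_comparison_test'[of _ 1]) (use bound in simp)
  hence "AE \<omega> in M. eventually (\<lambda>n. \<omega> \<in> space M - A n) sequentially"
    by (intro borel_cantelli_AE1) (auto simp: emeasure_eq_measure)
  thus ?thesis
  proof (rule AE_mp, intro AE_I2 impI)
    fix \<omega> assume ev: "eventually (\<lambda>n. \<omega> \<in> space M - A n) sequentially"
    show "eventually (\<lambda>n. real (card {j\<in>{1..n}. X j \<omega> \<in> E}) \<le> \<beta> * real n) sequentially"
      using ev
    proof eventually_elim
      case (elim n)
      have "real (card {j\<in>{1..n}. X j \<omega> \<in> E}) = (\<Sum>j\<in>{1..n}. Y j \<omega>)"
      proof -
        have "(\<Sum>j\<in>{1..n}. Y j \<omega>) = (\<Sum>j\<in>{1..n}. if X j \<omega> \<in> E then 1 else 0)"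
          unfolding Y_def by (intro sum.cong) auto
        also have "\<dots> = (\<Sum>j\<in>{j\<in>{1..n}. X j \<omega> \<in> E}. 1)" by (rule sum.inter_filter[symmetric]) simp
        finally show ?thesis by simp
      qed
      also have "\<dots> \<le> (\<Sum>j\<in>{1..n}. expectation (Y j)) + d * real n" using elim by (auto simp: A_def)
      also have "(\<Sum>j\<in>{1..n}. expectation (Y j)) = q * real n" by (simp add: EY)
      finally show ?case by (simp add: d_def algebra_simps)
    qed
  qed
qed

section \<open>Component families, priors and marginals\<close>

lemma component_familyD:
  assumes "component_family F"
  shows "param_space F \<in> sets lborel"
    and "x \<in> space (base F) \<Longrightarrow> (\<lambda>\<theta>. dens F \<theta> x) \<in> borel_measurable (restrict_space lborel (param_space F))"
    and "\<theta> \<in> param_space F \<Longrightarrow> x \<in> space (base F) \<Longrightarrow> dens F \<theta> x \<ge> 0"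
    and "\<theta> \<in> param_space F \<Longrightarrow> (\<integral>\<^sup>+x. ennreal (dens F \<theta> x) \<partial>base F) = 1"
    and "\<theta> \<in> param_space F \<Longrightarrow> dens F \<theta> \<in> borel_measurable (base F)"
proof -
  have m: "(\<lambda>(\<theta>, x). dens F \<theta> x) \<in> borel_measurable (restrict_space borel (param_space F) \<Otimes>\<^sub>M base F)"
    using assms by (simp add: component_family_def)
  have cong: "measurable (restrict_space lborel (param_space F)) B =
      measurable (restrict_space borel (param_space F)) B" for B :: "real measure"
    by (intro measurable_cong_sets) (simp_all add: sets_restrict_space)
  show "x \<in> space (base F) \<Longrightarrow> (\<lambda>\<theta>. dens F \<theta> x) \<in> borel_measurable (restrict_space lborel (param_space F))"
    using measurable_compose[OF measurable_Pair2' m] unfolding cong by simp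
  show "\<theta> \<in> param_space F \<Longrightarrow> dens F \<theta> \<in> borel_measurable (base F)"
    using measurable_compose[OF measurable_Pair1' m, of \<theta>] by (simp add: space_restrict_space)
qed (use assms in \<open>auto simp: component_family_def\<close>)

text \<open>A weakening of \<open>prior_density\<close> that a conjugate prior satisfies without any
  evaluation of its normalising integral. What matters later is whether the total mass is zero, and
  that case is split off by \<open>posterior_zero_prior\<close>.\<close>

definition prior_weight :: "('p::euclidean_space, 'x) family \<Rightarrow> ('p \<Rightarrow> real) \<Rightarrow> bool" where
  "prior_weight F \<pi> \<longleftrightarrow> \<pi> \<in> borel_measurable (restrict_space borel (param_space F)) \<and>
    (\<forall>\<theta>\<in>param_space F. 0 \<le> \<pi> \<theta>)"

lemma prior_weight_measurable:
  assumes "prior_weight F \<pi>"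
  shows "\<pi> \<in> borel_measurable (restrict_space lborel (param_space F))"
  using assms unfolding prior_weight_def
  by (subst measurable_cong_sets[of _ "restrict_space borel (param_space F)" _ borel])
     (simp_all add: sets_restrict_space)

lemma marginal_restrict_space:
  assumes "component_family F" "J \<noteq> {}"
  shows "marginal F \<pi> x J =
    (\<integral>\<^sup>+\<theta>. ennreal ((\<Prod>j\<in>J. dens F \<theta> (x j)) * \<pi> \<theta>) \<partial>restrict_space lborel (param_space F))"
  using assms component_familyD(1)[OF assms(1)]
  by (simp add: marginal_def nn_integral_restrict_space)

lemma marginal_pos:
  assumes F: "component_family F" and \<pi>: "prior_weight F \<pi>"
    and nz: "(\<integral>\<^sup>+\<theta>. ennreal (\<pi> \<theta>) \<partial>restrict_space lborel (param_space F)) \<noteq> 0"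
    and x: "x j \<in> space (base F)" and pos: "\<And>\<theta>. \<theta> \<in> param_space F \<Longrightarrow> dens F \<theta> (x j) > 0"
  shows "marginal F \<pi> x {j} > 0"
proof -
  let ?R = "restrict_space lborel (param_space F)"
  note [measurable] = component_familyD(2)[OF F x] prior_weight_measurable[OF \<pi>]
  have "marginal F \<pi> x {j} \<noteq> 0"
  proof
    assume "marginal F \<pi> x {j} = 0"
    hence "(\<integral>\<^sup>+\<theta>. ennreal (dens F \<theta> (x j) * \<pi> \<theta>) \<partial>?R) = 0"
      by (simp add: marginal_restrict_space[OF F])
    hence "AE \<theta> in ?R. ennreal (dens F \<theta> (x j) * \<pi> \<theta>) = 0"
      by (subst (asm) nn_integral_0_iff_AE) simp_all
    hence "AE \<theta> in ?R. ennreal (\<pi> \<theta>) = 0"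
    proof (rule AE_mp, intro AE_I2 impI)
      fix \<theta> assume "\<theta> \<in> space ?R" "ennreal (dens F \<theta> (x j) * \<pi> \<theta>) = 0"
      thus "ennreal (\<pi> \<theta>) = 0" using pos[of \<theta>]
        by (auto simp: space_restrict_space ennreal_eq_0_iff mult_le_0_iff)
    qed
    hence "(\<integral>\<^sup>+\<theta>. ennreal (\<pi> \<theta>) \<partial>?R) = 0" by (subst nn_integral_0_iff_AE) simp_all
    thus False using nz by simp
  qed
  thus ?thesis by (simp add: zero_less_iff_neq_zero)
qed

lemma iid_mixtureE:
  assumes "iid_mixture M t F X"
  obtains Q q \<theta> where "prob_space M" "prob_space.indep_vars M (\<lambda>_. base F) X {1..}"
    "\<And>j. j \<ge> 1 \<Longrightarrow> distr M (base F) (X j) = Q" "prob_space Q" "sets Q = sets (base F)"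
    "\<And>i. i \<in> {1..t} \<Longrightarrow> 0 \<le> q i \<and> \<theta> i \<in> param_space F" "(\<Sum>i=1..t. q i) = (1::real)"
    "\<And>B. B \<in> sets (base F) \<Longrightarrow> emeasure Q B = (\<Sum>i=1..t. ennreal (q i) * emeasure (component F (\<theta> i)) B)"
    "\<And>j \<omega>. j \<ge> 1 \<Longrightarrow> \<omega> \<in> space M \<Longrightarrow> X j \<omega> \<in> space (base F)"
proof -
  obtain Q where M: "prob_space M" and ind: "prob_space.indep_vars M (\<lambda>_. base F) X {1..}"
    and Q: "mixture_with t F Q" and d: "\<And>j. j \<ge> 1 \<Longrightarrow> distr M (base F) (X j) = Q"
    using assms unfolding iid_mixture_def by blast
  interpret prob_space M by fact
  have X: "X j \<in> measurable M (base F)" if "j \<ge> 1" for j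
    using ind that by (auto simp: indep_vars_def)
  \<comment> \<open>\<open>mixture_with\<close> does not state that \<open>Q\<close> is a
    probability measure; this holds because \<open>Q\<close> is the law of
    \<open>X 1\<close>.\<close>
  have "prob_space (distr M (base F) (X 1))" by (rule prob_space_distr) (simp add: X)
  hence "prob_space Q" using d[of 1] by simp
  with Q M ind d show ?thesis
    unfolding mixture_with_def using that measurable_space[OF X] by blast
qed

text \<open>Some weight \<open>q i\<close> is positive, and its component charges the common atom
  \<open>x0\<close>; hence \<open>Q\<close> does, and a positive fraction of the data equals
  \<open>x0\<close>. These observations share one single-point marginal \<open>m\<close>, so the
  cost of splitting them off is uniform.\<close>

theorem discrete_inconsistent:
  fixes F :: "('p::euclidean_space, 'x::euclidean_space) family"
  assumes py: "py_params \<sigma> \<theta>\<^sub>0" and t: "t \<ge> 1" and N: "\<not> (\<sigma> < 0 \<and> \<theta>\<^sub>0 = real t * \<bar>\<sigma>\<bar>)"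
    and F: "discrete_family F" and ne: "(\<Inter>\<theta>\<in>param_space F. {x \<in> space (base F). dens F \<theta> x > 0}) \<noteq> {}"
    and \<pi>: "prior_density F \<pi>" and fin: "finite_marginals F \<pi>" and iid: "iid_mixture M t F X"
  shows "AE \<omega> in M. limsup (\<lambda>n. ereal (posterior \<sigma> \<theta>\<^sub>0 F \<pi> n (\<lambda>j. X j \<omega>) t)) < 1"
proof -
  have cF: "component_family F" and bF: "base F = count_space (space (base F))"
    using F by (auto simp: discrete_family_def)
  obtain Q q \<theta> where M: "prob_space M" and ind: "prob_space.indep_vars M (\<lambda>_. base F) X {1..}"
    and dist: "\<And>j. j \<ge> 1 \<Longrightarrow> distr M (base F) (X j) = Q" and Q: "prob_space Q" and setsQ: "sets Q = sets (base F)"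
    and q: "\<And>i. i \<in> {1..t} \<Longrightarrow> 0 \<le> q i \<and> \<theta> i \<in> param_space F" and q1: "(\<Sum>i=1..t. q i) = (1::real)"
    and mix: "\<And>B. B \<in> sets (base F) \<Longrightarrow> emeasure Q B = (\<Sum>i=1..t. ennreal (q i) * emeasure (component F (\<theta> i)) B)"
    and Xsp: "\<And>j \<omega>. j \<ge> 1 \<Longrightarrow> \<omega> \<in> space M \<Longrightarrow> X j \<omega> \<in> space (base F)"
    by (rule iid_mixtureE[OF iid]) blast
  interpret prob_space M by fact
  interpret Q: prob_space Q by fact
  have pw: "prior_weight F \<pi>" using \<pi> by (auto simp: prior_density_def prior_weight_def)
  have \<pi>1: "(\<integral>\<^sup>+\<theta>. ennreal (\<pi> \<theta>) \<partial>restrict_space lborel (param_space F)) = 1"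
    using \<pi> component_familyD(1)[OF cF] by (simp add: prior_density_def nn_integral_restrict_space)
  have "\<theta> 1 \<in> param_space F" using q t by simp
  then obtain x0 where x0: "x0 \<in> space (base F)" and pos: "\<And>\<theta>. \<theta> \<in> param_space F \<Longrightarrow> dens F \<theta> x0 > 0"
    using ne by blast
  have setsF: "B \<in> sets (base F) \<longleftrightarrow> B \<subseteq> space (base F)" for B by (subst bF) simp
  have le1: "dens F \<theta> x0 \<le> 1" if "\<theta> \<in> param_space F" for \<theta>
  proof -
    have "ennreal (dens F \<theta> x0) = (\<integral>\<^sup>+x. ennreal (dens F \<theta> x) * indicator {x0} x \<partial>base F)"
      using x0 setsF by (subst nn_integral_indicator_singleton) (simp_all, subst bF, simp)
    also have "\<dots> \<le> (\<integral>\<^sup>+x. ennreal (dens F \<theta> x) \<partial>base F)"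
      by (intro nn_integral_mono) (auto simp: indicator_def)
    also have "\<dots> = 1" using component_familyD(4)[OF cF that] .
    finally show ?thesis by simp
  qed
  have Q0: "measure Q {x0} > 0"
  proof -
    obtain i where i: "i \<in> {1..t}" "q i > 0"
    proof (rule ccontr)
      assume "\<not> thesis"
      hence "\<forall>i\<in>{1..t}. q i = 0" using that q by force
      thus False using q1 by simp
    qed
    have m [measurable]: "dens F (\<theta> i) \<in> borel_measurable (base F)" using component_familyD(5)[OF cF] q i by blast
    have "emeasure (component F (\<theta> i)) {x0} = ennreal (dens F (\<theta> i) x0)"
      unfolding component_def using x0 setsF
      by (subst emeasure_density) (simp_all, subst bF, simp add: nn_integral_indicator_singleton)
    hence "0 < ennreal (q i) * emeasure (component F (\<theta> i)) {x0}"
      using i pos[of "\<theta> i"] q by (simp add: ennreal_zero_less_mult_iff)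
    also have "\<dots> \<le> emeasure Q {x0}"
      using i x0 setsF by (subst mix) (auto intro!: member_le_sum)
    finally show ?thesis by (simp add: Q.emeasure_eq_measure)
  qed
  \<comment> \<open>Half of the mass of \<open>x0\<close> is given away to make the inequality
    strict; \<open>1 - \<beta>\<close> is the guaranteed fraction of observations equal to
    \<open>x0\<close>.\<close>
  define \<beta> where "\<beta> = 1 - measure Q {x0} / 2"
  have spQ: "space Q = space (base F)" using setsQ by (rule sets_eq_imp_space_eq)
  have "measure Q (space (base F) - {x0}) = 1 - measure Q {x0}"
    using Q.prob_compl[of "{x0}"] x0 setsF setsQ spQ by simp
  hence "measure Q (space (base F) - {x0}) < \<beta>" using Q0 by (simp add: \<beta>_def)
  from AE_eventually_card_le[OF ind dist _ this] setsF
  have "AE \<omega> in M. eventually (\<lambda>n. real (card {j\<in>{1..n}. X j \<omega> \<in> space (base F) - {x0}}) \<le> \<beta> * real n) sequentially"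
    by blast
  thus ?thesis
  proof (rule AE_mp, intro AE_I2 impI)
    fix \<omega> assume \<omega>: "\<omega> \<in> space M"
      and ev: "eventually (\<lambda>n. real (card {j\<in>{1..n}. X j \<omega> \<in> space (base F) - {x0}}) \<le> \<beta> * real n) sequentially"
    define x where "x j = X j \<omega>" for j
    define mu where "mu J = enn2real (marginal F \<pi> x J)" for J
    have xsp: "x j \<in> space (base F)" if "j \<ge> 1" for j using Xsp[OF that \<omega>] by (simp add: x_def)
    have finm: "marginal F \<pi> x J < \<top>" if "J \<subseteq> {1..n}" for J n
    proof -
      have "finite J" by (rule finite_subset[OF that]) simp
      moreover have "\<forall>j\<in>J. x j \<in> space (base F)" using that xsp by (auto simp: subset_iff)
      ultimately have "marginal F \<pi> x J < \<infinity>" using fin unfolding finite_marginals_def by blast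
      thus ?thesis by simp
    qed
    define m where "m = enn2real (marginal F \<pi> (\<lambda>_. x0) {0})"
    have "marginal F \<pi> (\<lambda>_. x0) {0::nat} > 0"
      by (rule marginal_pos[OF cF pw]) (use x0 pos \<pi>1 in auto)
    moreover have "marginal F \<pi> (\<lambda>_. x0) {0::nat} < \<top>"
      using fin x0 unfolding finite_marginals_def by simp
    ultimately have m: "m > 0" by (simp add: m_def enn2real_positive_iff)
    have single: "mu {j} = m" if "x j = x0" for j using that by (simp add: mu_def m_def marginal_def)
    \<comment> \<open>The summand 1 serves the part \<open>{j}\<close>, where the marginal of the
      empty set is 1; the summand \<open>1 / m\<close> serves the larger parts, where dropping
      \<open>x j\<close> does not decrease the marginal.\<close>
    have good: "mu J \<le> (1 + 1 / m) * mu (J - {j}) * mu {j}" if J: "J \<subseteq> {1..n}" "j \<in> J" "x j = x0" for J j n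
    proof (cases "J = {j}")
      case True
      thus ?thesis using m single[OF J(3)] by (simp add: mu_def[of "{}"] marginal_def field_simps)
    next
      case False
      hence ne: "J \<noteq> {}" "J - {j} \<noteq> {}" using J by auto
      have "finite J" using J(1) finite_subset by blast
      have "marginal F \<pi> x J \<le> marginal F \<pi> x (J - {j})"
        unfolding marginal_restrict_space[OF cF ne(1)] marginal_restrict_space[OF cF ne(2)]
      proof (intro nn_integral_mono ennreal_leI mult_right_mono)
        fix \<theta> assume "\<theta> \<in> space (restrict_space lborel (param_space F))"
        hence \<theta>: "\<theta> \<in> param_space F" by (simp add: space_restrict_space)
        show "\<pi> \<theta> \<ge> 0" using pw \<theta> by (simp add: prior_weight_def)
        have "(\<Prod>i\<in>J. dens F \<theta> (x i)) = dens F \<theta> x0 * (\<Prod>i\<in>J - {j}. dens F \<theta> (x i))"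
          using J \<open>finite J\<close> by (subst prod.remove[of _ j]) auto
        also have "\<dots> \<le> 1 * (\<Prod>i\<in>J - {j}. dens F \<theta> (x i))"
          using le1[OF \<theta>] component_familyD(3)[OF cF \<theta>] xsp J by (intro mult_right_mono prod_nonneg) auto
        finally show "(\<Prod>i\<in>J. dens F \<theta> (x i)) \<le> (\<Prod>i\<in>J - {j}. dens F \<theta> (x i))" by simp
      qed
      hence le: "mu J \<le> mu (J - {j})"
        unfolding mu_def using finm[of "J - {j}" n] J by (intro enn2real_mono) auto
      have "mu (J - {j}) \<ge> 0" by (simp add: mu_def)
      hence "mu (J - {j}) \<le> (m + 1) * mu (J - {j})" using m by (simp add: algebra_simps)
      also have "\<dots> = (1 + 1 / m) * mu (J - {j}) * m" using m by (simp add: field_simps)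
      finally show ?thesis using le single[OF J(3)] by simp
    qed
    have "limsup (\<lambda>n. ereal (posterior \<sigma> \<theta>\<^sub>0 F \<pi> n x t)) < 1"
    proof (rule posterior_limsup_less_one[OF py t N, of "1 + 1 / m" "1 - \<beta>"])
      show "1 - \<beta> > 0" using Q0 by (simp add: \<beta>_def)
      show "1 + 1 / m \<ge> 0" using m by simp
      show "eventually (\<lambda>n. \<forall>A\<in>ordered_partitions t n. (1 - \<beta>) * real n \<le> card {j. \<exists>l<t. j \<in> A ! l \<and>
        enn2real (marginal F \<pi> x (A ! l)) \<le> (1 + 1 / m) * enn2real (marginal F \<pi> x (A ! l - {j})) *
          enn2real (marginal F \<pi> x {j})}) sequentially"
        using ev unfolding mu_def[symmetric]
      proof eventually_elim
        case (elim n)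
        show ?case
        proof
          fix A assume A: "A \<in> ordered_partitions t n"
          let ?S = "{j. \<exists>l<t. j \<in> A ! l \<and> mu (A ! l) \<le> (1 + 1 / m) * mu (A ! l - {j}) * mu {j}}"
          let ?B = "{j\<in>{1..n}. X j \<omega> \<in> space (base F) - {x0}}"
          have un: "(\<Union>l<t. A ! l) = {1..n}" using A by (simp add: ordered_partitions_def)
          have "?S \<subseteq> {1..n}" using un by blast
          hence fS: "finite ?S" using finite_subset by blast
          have "{1..n} \<subseteq> ?S \<union> ?B"
          proof
            fix j assume j: "j \<in> {1..n}"
            then obtain l where l: "l < t" "j \<in> A ! l" using un by blast
            show "j \<in> ?S \<union> ?B"
            proof (cases "x j = x0")
              case True
              have "A ! l \<subseteq> {1..n}" using un l by blast
              from good[OF this l(2) True] l show ?thesis by blast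
            qed (use j xsp in \<open>auto simp: x_def\<close>)
          qed
          hence "card {1..n} \<le> card (?S \<union> ?B)" using fS by (intro card_mono) auto
          also have "\<dots> \<le> card ?S + card ?B" by (rule card_Un_le)
          finally have "real n \<le> real (card ?S) + real (card ?B)" by simp
          thus "(1 - \<beta>) * real n \<le> real (card ?S)" using elim by (simp add: algebra_simps)
        qed
      qed
    qed
    thus "limsup (\<lambda>n. ereal (posterior \<sigma> \<theta>\<^sub>0 F \<pi> n (\<lambda>j. X j \<omega>) t)) < 1" unfolding x_def .
  qed
qed

section \<open>Slabs and convex hulls\<close>

text \<open>Slabs are parametrised by their normal and offset. Hyperplane sections of
  \<open>K\<close> are null, so by continuity from above each parameter has a slab of positive
  half-width and measure below \<open>\<beta>\<close>. It contains the thinner slabs of all nearby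
  parameters within \<open>K\<close>, and finitely many such neighbourhoods cover the compact
  parameter set.\<close>

lemma slab_cover:
  fixes Q :: "'a::euclidean_space measure"
  assumes Q: "prob_space Q" and K: "compact K" and meas: "\<And>B. B \<in> sets borel \<Longrightarrow> K \<inter> B \<in> sets Q"
    and null: "\<And>u c. norm u = 1 \<Longrightarrow> measure Q (K \<inter> {x. u \<bullet> x = c}) = 0" and \<beta>: "\<beta> > 0"
  obtains \<delta> \<F> where "\<delta> > 0" "finite \<F>" "\<F> \<subseteq> sets Q" "\<And>E. E \<in> \<F> \<Longrightarrow> measure Q E < \<beta>"
    "\<And>u c. norm u = 1 \<Longrightarrow> \<exists>E\<in>\<F>. {x\<in>K. \<bar>u \<bullet> x - c\<bar> \<le> \<delta>} \<subseteq> E"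
proof -
  interpret prob_space Q by (rule Q)
  obtain R where R: "R > 0" "\<And>x. x \<in> K \<Longrightarrow> norm x \<le> R"
    using compact_imp_bounded[OF K] by (auto simp: bounded_pos)
  define S where "S u c e = K \<inter> {x. \<bar>u \<bullet> x - c\<bar> \<le> e}" for u :: 'a and c e :: real
  have S_sets: "S u c e \<in> sets Q" for u c e
    unfolding S_def by (rule meas) (intro borel_closed closed_Collect_le continuous_intros)
  have "\<exists>e>0. measure Q (S (fst p) (snd p) e) < \<beta>" if "norm (fst p) = 1" for p :: "'a \<times> real"
  proof -
    obtain u c where p: "p = (u, c)" by (cases p)
    have "(\<lambda>n. measure Q (S u c (inverse (Suc n)))) \<longlonglongrightarrow> measure Q (\<Inter>n. S u c (inverse (Suc n)))"
    proof (rule finite_Lim_measure_decseq)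
      show "range (\<lambda>n. S u c (inverse (Suc n))) \<subseteq> sets Q" using S_sets by auto
      show "decseq (\<lambda>n. S u c (inverse (Suc n)))"
      proof (rule decseq_SucI)
        fix n
        have "inverse (real (Suc (Suc n))) \<le> inverse (real (Suc n))" by (intro le_imp_inverse_le) auto
        thus "S u c (inverse (Suc (Suc n))) \<subseteq> S u c (inverse (Suc n))" unfolding S_def by (auto simp del: of_nat_Suc intro: order_trans)
      qed
    qed
    also have "(\<Inter>n. S u c (inverse (Suc n))) = K \<inter> {x. u \<bullet> x = c}"
    proof (intro equalityI subsetI)
      fix x assume x: "x \<in> (\<Inter>n. S u c (inverse (Suc n)))"
      have "(\<lambda>n. inverse (real (Suc n))) \<longlonglongrightarrow> 0" by (rule LIMSEQ_inverse_real_of_nat)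
      hence "\<bar>u \<bullet> x - c\<bar> \<le> 0" by (rule LIMSEQ_le_const) (use x in \<open>auto simp: S_def\<close>)
      thus "x \<in> K \<inter> {x. u \<bullet> x = c}" using x by (auto simp: S_def)
    qed (auto simp: S_def)
    also have "measure Q \<dots> = 0" using null that p by simp
    finally have "eventually (\<lambda>n. measure Q (S u c (inverse (Suc n))) < \<beta>) sequentially"
      using \<beta> by (rule order_tendstoD(2))
    then obtain n where "measure Q (S u c (inverse (Suc n))) < \<beta>" by (auto simp: eventually_sequentially)
    thus ?thesis unfolding p by (intro exI[of _ "inverse (Suc n)"]) auto
  qed
  then obtain e where e: "\<And>p. norm (fst p) = 1 \<Longrightarrow> e p > 0 \<and> measure Q (S (fst p) (snd p) (e p)) < \<beta>" by metis
  define P where "P = sphere (0::'a) 1 \<times> cball (0::real) (R + 1)"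
  \<comment> \<open>Within distance \<open>r p\<close> the change of normal costs at most
    \<open>r p * R\<close> on \<open>K\<close> and the change of offset at most \<open>r p\<close>,
    together \<open>e p / 2\<close>; the other half is left for \<open>\<delta>\<close>.\<close>
  define r where "r p = e p / 2 / (R + 1)" for p
  have R1: "R + 1 \<noteq> 0" using R(1) by simp
  have nP: "norm (fst p) = 1" if "p \<in> P" for p using that by (auto simp: P_def)
  have "compact P" unfolding P_def by (intro compact_Times) auto
  moreover have "P \<subseteq> (\<Union>p\<in>P. ball p (r p))"
  proof
    fix p assume p: "p \<in> P"
    have "r p > 0" using e[OF nP[OF p]] R(1) by (simp add: r_def)
    thus "p \<in> (\<Union>p\<in>P. ball p (r p))" using p by (auto intro!: bexI[of _ p])
  qed
  ultimately obtain C where C: "C \<subseteq> P" "finite C" "P \<subseteq> (\<Union>p\<in>C. ball p (r p))"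
    using compactE_image[of P P "\<lambda>p. ball p (r p)"] by blast
  \<comment> \<open>The entry 1 keeps \<open>\<delta> <= 1\<close>, so that slabs with offset beyond
    \<open>R + 1\<close> miss \<open>K\<close>; the empty set in \<open>\<F>\<close> covers
    those.\<close>
  define \<delta> where "\<delta> = Min (insert 1 ((\<lambda>p. e p / 2) ` C))"
  define \<F> where "\<F> = insert {} ((\<lambda>p. S (fst p) (snd p) (e p)) ` C)"
  have d0: "\<delta> > 0" unfolding \<delta>_def using C e nP by (subst Min_gr_iff) auto
  have d1: "\<delta> \<le> 1" unfolding \<delta>_def using C by (intro Min_le) auto
  have dC: "\<delta> \<le> e p / 2" if "p \<in> C" for p unfolding \<delta>_def using C that by (intro Min_le) auto
  show ?thesis
  proof (rule that[of \<delta> \<F>])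
    show "measure Q E < \<beta>" if "E \<in> \<F>" for E using that e nP C \<beta> by (auto simp: \<F>_def)
    show "\<exists>E\<in>\<F>. {x\<in>K. \<bar>u \<bullet> x - c\<bar> \<le> \<delta>} \<subseteq> E" if u: "norm u = 1" for u :: 'a and c :: real
    proof (cases "\<bar>c\<bar> \<le> R + 1")
      case True
      hence "(u, c) \<in> P" using u by (simp add: P_def)
      then obtain p where p: "p \<in> C" "dist p (u, c) < r p" using C(3) by auto
      obtain u' c' where p': "p = (u', c')" by (cases p)
      have du: "norm (u' - u) < r p" using dist_fst_le[of p "(u, c)"] p by (simp add: p' dist_norm)
      have dc: "\<bar>c' - c\<bar> < r p" using dist_snd_le[of p "(u, c)"] p by (simp add: p' dist_norm)
      have "{x\<in>K. \<bar>u \<bullet> x - c\<bar> \<le> \<delta>} \<subseteq> S u' c' (e p)"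
      proof
        fix x assume x: "x \<in> {x\<in>K. \<bar>u \<bullet> x - c\<bar> \<le> \<delta>}"
        hence hx: "\<bar>u \<bullet> x - c\<bar> \<le> \<delta>" by simp
        have "\<bar>(u' - u) \<bullet> x\<bar> \<le> norm (u' - u) * norm x" by (rule Cauchy_Schwarz_ineq2)
        also have "\<dots> \<le> r p * R" using du R(2)[of x] x order.strict_trans1[OF norm_ge_zero du]
          by (intro mult_mono) auto
        finally have 1: "\<bar>u' \<bullet> x - u \<bullet> x\<bar> \<le> r p * R" by (simp add: inner_diff_left)
        have le: "\<bar>u' \<bullet> x - c'\<bar> \<le> \<delta> + r p * R + r p" using 1 hx dc by linarith
        have "r p * (R + 1) = e p / 2" unfolding r_def by (rule nonzero_eq_divide_eq[OF R1, THEN iffD1]) (rule refl)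
        hence "\<delta> + r p * R + r p \<le> e p" using dC[OF p(1)] by (simp add: distrib_left)
        with le have "\<bar>u' \<bullet> x - c'\<bar> \<le> e p" by linarith
        thus "x \<in> S u' c' (e p)" using x by (simp add: S_def)
      qed
      moreover have "S u' c' (e p) \<in> \<F>" using imageI[OF p(1), of "\<lambda>p. S (fst p) (snd p) (e p)"]
        by (simp add: \<F>_def p')
      ultimately show ?thesis by blast
    next
      case False
      have "{x\<in>K. \<bar>u \<bullet> x - c\<bar> \<le> \<delta>} = {}"
      proof -
        have "\<not> \<bar>u \<bullet> x - c\<bar> \<le> \<delta>" if "x \<in> K" for x
        proof -
          have "\<bar>u \<bullet> x\<bar> \<le> R" using Cauchy_Schwarz_ineq2[of u x] R(2)[OF that] unfolding u by linarith
          thus ?thesis using False d1 by linarith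
        qed
        thus ?thesis by blast
      qed
      thus ?thesis by (simp add: \<F>_def)
    qed
  qed (use d0 C S_sets in \<open>auto simp: \<F>_def\<close>)
qed

text \<open>A ball around the centroid that leaves the hull is cut off by a half-space; all points of \<open>T\<close>
  then lie at bounded height, on average at height zero, hence in a slab.\<close>

lemma ball_subset_convex_hull:
  fixes T :: "'a::euclidean_space set"
  assumes T: "finite T" "T \<noteq> {}" and M: "card T \<le> M" and \<delta>: "\<delta> > 0"
    and slab: "\<And>u c. norm u = 1 \<Longrightarrow> \<exists>x\<in>T. \<bar>u \<bullet> x - c\<bar> > \<delta>"
  shows "\<exists>z. ball z (\<delta> / real M) \<subseteq> convex hull T"
proof -
  define z where "z = \<Sum>T /\<^sub>R real (card T)"
  \<comment> \<open>If all heights over the centroid exceed \<open>-r\<close> and sum to zero, each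
    is at most \<open>(card T - 1) * r\<close>, and this choice of \<open>r\<close> keeps that below
    \<open>\<delta>\<close>.\<close>
  define r where "r = \<delta> / real M"
  have cT: "card T > 0" using T by (simp add: card_gt_0_iff)
  have r: "r > 0" "real (card T) * r \<le> \<delta>" using cT M \<delta> by (auto simp: r_def field_simps)
  have "ball z r \<subseteq> convex hull T"
  proof
    fix y assume y: "y \<in> ball z r"
    show "y \<in> convex hull T"
    proof (rule ccontr)
      assume "y \<notin> convex hull T"
      moreover have "closed (convex hull T)" using T by (intro compact_imp_closed finite_imp_compact_convex_hull)
      ultimately obtain a b where ab: "a \<bullet> y < b" "\<And>x. x \<in> convex hull T \<Longrightarrow> a \<bullet> x > b"
        using separating_hyperplane_closed_point[of "convex hull T" y] by auto
      have abT: "a \<bullet> x > a \<bullet> y" if "x \<in> T" for x using ab hull_inc[OF that, of convex] by force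
      have "a \<noteq> 0" using abT T by force
      define u where "u = a /\<^sub>R norm a"
      have u: "norm u = 1" using \<open>a \<noteq> 0\<close> by (simp add: u_def)
      have uy: "u \<bullet> x > u \<bullet> y" if "x \<in> T" for x
        using abT[OF that] \<open>a \<noteq> 0\<close> by (simp add: u_def divide_strict_right_mono)
      have "\<bar>u \<bullet> (z - y)\<bar> \<le> norm (z - y)" using Cauchy_Schwarz_ineq2[of u "z - y"] u by simp
      also have "\<dots> < r" using y by (simp add: dist_norm)
      finally have low: "u \<bullet> x - u \<bullet> z > - r" if "x \<in> T" for x using uy[OF that] by (auto simp: inner_diff_right)
      have "(\<Sum>x\<in>T. u \<bullet> x - u \<bullet> z) = u \<bullet> \<Sum>T - real (card T) * (u \<bullet> z)"
        by (simp add: sum_subtractf inner_sum_right)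
      also have "\<dots> = 0" using cT by (simp add: z_def)
      finally have s0: "(\<Sum>x\<in>T. u \<bullet> x - u \<bullet> z) = 0" .
      have "\<bar>u \<bullet> x - u \<bullet> z\<bar> \<le> \<delta>" if x: "x \<in> T" for x
      proof -
        have "(\<Sum>x\<in>T - {x}. - r) \<le> (\<Sum>x\<in>T - {x}. u \<bullet> x - u \<bullet> z)"
          using low by (intro sum_mono) (auto intro: less_imp_le)
        hence "- (real (card T - 1) * r) \<le> - (u \<bullet> x - u \<bullet> z)"
          using s0 x T by (simp add: sum.remove[of T x] algebra_simps)
        moreover have "real (card T - 1) * r \<le> real (card T) * r" using r by (intro mult_right_mono) auto
        moreover have "1 * r \<le> real (card T) * r" using cT r by (intro mult_right_mono) auto
        ultimately show ?thesis using low[OF x] r by linarith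
      qed
      thus False using slab[OF u, of "u \<bullet> z"] by force
    qed
  qed
  thus ?thesis unfolding r_def by blast
qed

text \<open>The number of hull points enters the splitting cost, so it has to be bounded
  independently of \<open>B\<close>, that is, of the sample size and the partition. The net consists
  of indices, since observations are removed by index.\<close>

lemma compact_index_net:
  fixes K :: "'a::metric_space set"
  assumes K: "compact K" and \<eta>: "\<eta> > 0"
  shows "\<exists>M. \<forall>B (x :: 'i \<Rightarrow> 'a). x ` B \<subseteq> K \<longrightarrow>
    (\<exists>T\<subseteq>B. finite T \<and> card T \<le> M \<and> (\<forall>j\<in>B. \<exists>i\<in>T. dist (x i) (x j) \<le> \<eta>))"
proof -
  obtain C where C: "finite C" "K \<subseteq> (\<Union>c\<in>C. ball c (\<eta> / 2))"
  proof (rule compactE_image[OF K, of K "\<lambda>c. ball c (\<eta> / 2)"])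
    show "K \<subseteq> (\<Union>c\<in>K. ball c (\<eta> / 2))" using \<eta> by (auto intro!: bexI)
  qed auto
  show ?thesis
  proof (intro exI[of _ "card C"] allI impI)
    fix B and x :: "'i \<Rightarrow> 'a" assume B: "x ` B \<subseteq> K"
    define D where "D = {c\<in>C. \<exists>j\<in>B. dist c (x j) < \<eta> / 2}"
    define p where "p c = (SOME j. j \<in> B \<and> dist c (x j) < \<eta> / 2)" for c
    have p: "p c \<in> B \<and> dist c (x (p c)) < \<eta> / 2" if "c \<in> D" for c
      unfolding p_def by (rule someI_ex) (use that in \<open>auto simp: D_def\<close>)
    have D: "finite D" "card D \<le> card C" using C(1) by (auto simp: D_def intro: card_mono)
    show "\<exists>T\<subseteq>B. finite T \<and> card T \<le> card C \<and> (\<forall>j\<in>B. \<exists>i\<in>T. dist (x i) (x j) \<le> \<eta>)"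
    proof (intro exI[of _ "p ` D"] conjI ballI)
      show "card (p ` D) \<le> card C" using card_image_le[OF D(1), of p] D(2) by linarith
      fix j assume j: "j \<in> B"
      hence "x j \<in> (\<Union>c\<in>C. ball c (\<eta> / 2))" using C(2) B by blast
      then obtain c where c: "c \<in> C" "dist c (x j) < \<eta> / 2" by auto
      hence "c \<in> D" using j by (auto simp: D_def)
      have "dist (x (p c)) (x j) \<le> dist c (x (p c)) + dist c (x j)" by (rule dist_triangle3)
      hence "dist (x (p c)) (x j) \<le> \<eta>" using c p[OF \<open>c \<in> D\<close>] by linarith
      thus "\<exists>i\<in>p ` D. dist (x i) (x j) \<le> \<eta>" using \<open>c \<in> D\<close> by blast
    qed (use p D in auto)
  qed
qed

section \<open>Removing an observation under quasi-concave densities\<close>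

lemma quasiconcave_density_min_le:
  assumes F: "component_family F" and \<theta>: "\<theta> \<in> param_space F"
    and qc: "\<And>r. convex {x\<in>space (base F). r \<le> dens F \<theta> x}"
    and T: "finite T" "T \<noteq> {}" "T \<subseteq> space (base F)"
    and B: "B \<in> sets (base F)" "B \<subseteq> convex hull T" "ennreal V \<le> emeasure (base F) B" and V: "V > 0"
  shows "\<exists>y\<in>T. dens F \<theta> y \<le> 1 / V"
proof (rule ccontr)
  assume "\<not> ?thesis"
  hence gr: "\<And>y. y \<in> T \<Longrightarrow> dens F \<theta> y > 1 / V" by force
  define m where "m = Min (dens F \<theta> ` T)"
  have m: "m > 1 / V" unfolding m_def using T gr by (subst Min_gr_iff) auto
  have "T \<subseteq> {x\<in>space (base F). m \<le> dens F \<theta> x}" using T by (auto simp: m_def)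
  \<comment> \<open>The superlevel set at the minimum over \<open>T\<close> is convex, so it
    contains the hull and with it \<open>B\<close>; the density is at least \<open>m\<close> on
    \<open>B\<close> but has total mass 1.\<close>
  hence hull: "convex hull T \<subseteq> {x\<in>space (base F). m \<le> dens F \<theta> x}" by (rule hull_minimal) (rule qc)
  have m0: "m > 0" by (rule less_trans[OF _ m]) (use V in simp)
  from hull have ge: "m \<le> dens F \<theta> x" if "x \<in> B" for x using B that by blast
  have "ennreal (m * V) = ennreal m * ennreal V"
    using m0 V by (intro ennreal_mult) auto
  also have "\<dots> \<le> ennreal m * emeasure (base F) B" using B by (intro mult_left_mono) auto
  also have "\<dots> = (\<integral>\<^sup>+x. ennreal m * indicator B x \<partial>base F)" using B by (subst nn_integral_cmult_indicator) auto
  also have "\<dots> \<le> (\<integral>\<^sup>+x. ennreal (dens F \<theta> x) \<partial>base F)"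
    using ge by (intro nn_integral_mono) (auto simp: indicator_def intro: ennreal_leI)
  also have "\<dots> = 1" by (rule component_familyD(4)[OF F \<theta>])
  finally have "m * V \<le> 1" by simp
  thus False using m V by (simp add: field_simps)
qed

text \<open>Which point of \<open>T\<close> has small density depends on \<theta>, so the integrand
  is bounded by a sum over all of \<open>T\<close>. After integration, one of the at most
  \<open>M\<close> summands is at least the average.\<close>

lemma marginal_remove_point:
  assumes F: "component_family F" and \<pi>: "prior_weight F \<pi>" and fin: "finite_marginals F \<pi>"
    and x: "\<And>j. j \<in> J \<Longrightarrow> x j \<in> space (base F)"
    and J: "finite J" and two: "card J \<ge> 2" and T: "T \<subseteq> J" "T \<noteq> {}" "card T \<le> M" and V: "V > 0"
    and min: "\<And>\<theta>. \<theta> \<in> param_space F \<Longrightarrow> \<exists>j\<in>T. dens F \<theta> (x j) \<le> 1 / V"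
  shows "\<exists>j\<in>T. V * enn2real (marginal F \<pi> x J) \<le> real M * enn2real (marginal F \<pi> x (J - {j}))"
proof (rule ccontr)
  let ?R = "restrict_space lborel (param_space F)"
  let ?L = "\<lambda>J \<theta>. (\<Prod>i\<in>J. dens F \<theta> (x i)) * \<pi> \<theta>"
  define mu where "mu J = enn2real (marginal F \<pi> x J)" for J
  assume "\<not> ?thesis"
  hence less: "\<And>j. j \<in> T \<Longrightarrow> real M * mu (J - {j}) < V * mu J" by (force simp: mu_def)
  have mu0: "mu I \<ge> 0" for I by (simp add: mu_def)
  have fT: "finite T" using T J finite_subset by blast
  have M: "M > 0" using T fT by (metis card_gt_0_iff order.strict_trans2)
  \<comment> \<open>This guarantees that \<open>marginal\<close> at \<open>J - {j}\<close> is given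
    by the integral and not by the convention value 1 for the empty set.\<close>
  have "J - {j} \<noteq> {}" for j
  proof
    assume "J - {j} = {}"
    hence "card J \<le> card {j}" by (intro card_mono) auto
    thus False using two by simp
  qed
  note ne = this
  have finm: "marginal F \<pi> x I = ennreal (mu I)" if "I \<subseteq> J" for I
  proof -
    have "marginal F \<pi> x I < \<infinity>"
      using fin that x finite_subset[OF that J] unfolding finite_marginals_def by blast
    thus ?thesis by (simp add: mu_def)
  qed
  have [measurable]: "\<pi> \<in> borel_measurable ?R" by (rule prior_weight_measurable[OF \<pi>])
  have meas: "(\<lambda>\<theta>. ennreal (?L I \<theta>)) \<in> borel_measurable ?R" if "I \<subseteq> J" for I
    using that x component_familyD(2)[OF F] by (intro measurable_compose[OF _ measurable_ennreal]
      borel_measurable_times borel_measurable_prod) auto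
  have nn: "?L I \<theta> \<ge> 0" if "I \<subseteq> J" "\<theta> \<in> param_space F" for I \<theta>
    using that x component_familyD(3)[OF F] \<pi> unfolding prior_weight_def
    by (intro mult_nonneg_nonneg prod_nonneg) auto
  have "J \<noteq> {}" using two by auto
  have "ennreal (V * mu J) = ennreal V * marginal F \<pi> x J"
    using V mu0 by (simp add: finm ennreal_mult)
  also have "\<dots> = (\<integral>\<^sup>+\<theta>. ennreal V * ennreal (?L J \<theta>) \<partial>?R)"
    unfolding marginal_restrict_space[OF F \<open>J \<noteq> {}\<close>] using meas[of J] by (subst nn_integral_cmult) auto
  also have "\<dots> \<le> (\<integral>\<^sup>+\<theta>. (\<Sum>j\<in>T. ennreal (?L (J - {j}) \<theta>)) \<partial>?R)"
  proof (intro nn_integral_mono)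
    fix \<theta> assume "\<theta> \<in> space ?R"
    hence \<theta>: "\<theta> \<in> param_space F" by (simp add: space_restrict_space)
    obtain j where j: "j \<in> T" "dens F \<theta> (x j) \<le> 1 / V" using min[OF \<theta>] by blast
    have "?L J \<theta> = dens F \<theta> (x j) * ?L (J - {j}) \<theta>"
      using j T J by (subst prod.remove[of _ j]) auto
    also have "\<dots> \<le> 1 / V * ?L (J - {j}) \<theta>" using j nn[OF _ \<theta>] by (intro mult_right_mono) auto
    finally have "V * ?L J \<theta> \<le> ?L (J - {j}) \<theta>" using V by (simp add: field_simps)
    hence "ennreal V * ennreal (?L J \<theta>) \<le> ennreal (?L (J - {j}) \<theta>)"
      using V nn[OF _ \<theta>, of J] by (simp add: ennreal_leI flip: ennreal_mult)
    also have "\<dots> \<le> (\<Sum>j\<in>T. ennreal (?L (J - {j}) \<theta>))"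
      using j fT by (intro member_le_sum) auto
    finally show "ennreal V * ennreal (?L J \<theta>) \<le> (\<Sum>j\<in>T. ennreal (?L (J - {j}) \<theta>))" .
  qed
  also have "\<dots> = (\<Sum>j\<in>T. \<integral>\<^sup>+\<theta>. ennreal (?L (J - {j}) \<theta>) \<partial>?R)"
    using meas by (intro nn_integral_sum) auto
  also have "\<dots> = (\<Sum>j\<in>T. marginal F \<pi> x (J - {j}))"
    by (intro sum.cong marginal_restrict_space[OF F ne, symmetric] refl)
  also have "\<dots> = ennreal (\<Sum>j\<in>T. mu (J - {j}))"
    using mu0 by (subst sum_ennreal[symmetric]) (auto simp: finm)
  finally have le: "V * mu J \<le> (\<Sum>j\<in>T. mu (J - {j}))"
    by (subst (asm) ennreal_le_iff) (auto simp: mu0 intro: sum_nonneg)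
  have "(\<Sum>j\<in>T. mu (J - {j})) < (\<Sum>j\<in>T. V * mu J / real M)"
    using less M fT T by (intro sum_strict_mono) (auto simp: field_simps)
  also have "\<dots> = (real (card T) / real M) * (V * mu J)" by simp
  also have "\<dots> \<le> 1 * (V * mu J)"
    using T M V by (intro mult_right_mono) (auto simp: mu0)
  finally show False using le by simp
qed

text \<open>Every marginal of a nonempty set vanishes, hence so does the joint weight of
  \<open>t\<close>. This covers a parameter space of Lebesgue measure zero.\<close>

lemma posterior_zero_prior:
  assumes F: "component_family F" and \<pi>: "prior_weight F \<pi>" and t: "t \<ge> 1"
    and zero: "(\<integral>\<^sup>+\<theta>. ennreal (\<pi> \<theta>) \<partial>restrict_space lborel (param_space F)) = 0"
  shows "posterior \<sigma> \<theta>\<^sub>0 F \<pi> n x t = 0"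
proof -
  let ?R = "restrict_space lborel (param_space F)"
  have [measurable]: "\<pi> \<in> borel_measurable ?R" by (rule prior_weight_measurable[OF \<pi>])
  have AE: "AE \<theta> in ?R. ennreal (\<pi> \<theta>) = 0" using zero by (subst (asm) nn_integral_0_iff_AE) simp_all
  have "marginal F \<pi> x J = 0" if "J \<noteq> {}" for J
  proof -
    have "marginal F \<pi> x J = (\<integral>\<^sup>+\<theta>. 0 \<partial>?R)"
      unfolding marginal_restrict_space[OF F that]
    proof (rule nn_integral_cong_AE, rule AE_mp[OF AE], intro AE_I2 impI)
      fix \<theta> assume "\<theta> \<in> space ?R" "ennreal (\<pi> \<theta>) = 0"
      hence "\<pi> \<theta> = 0" using \<pi> by (auto simp: prior_weight_def space_restrict_space ennreal_eq_0_iff intro: antisym)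
      thus "ennreal ((\<Prod>j\<in>J. dens F \<theta> (x j)) * \<pi> \<theta>) = 0" by simp
    qed
    thus ?thesis by simp
  qed
  hence "joint \<sigma> \<theta>\<^sub>0 F \<pi> n x t = 0"
    unfolding joint_def using t by (intro sum.neutral) (fastforce simp: ordered_partitions_def)
  thus ?thesis by (simp add: posterior_def Let_def)
qed

text \<open>Makes the set where the single-point marginal is bounded below an event to which the law
  of large numbers applies.\<close>

lemma marginal_measurable:
  assumes F: "component_family F" and \<pi>: "prior_weight F \<pi>"
  shows "(\<lambda>x. marginal F \<pi> (\<lambda>_. x) {i}) \<in> borel_measurable (base F)"
proof -
  let ?R = "restrict_space lborel (param_space F)"
  interpret R: sigma_finite_measure ?R
    using component_familyD(1)[OF F] by (intro sigma_finite_measure_restrict_space sigma_finite_lborel)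
  have sets: "sets ?R = sets (restrict_space borel (param_space F))" by (simp add: sets_restrict_space)
  have [measurable]: "\<pi> \<in> borel_measurable ?R" by (rule prior_weight_measurable[OF \<pi>])
  have "(\<lambda>(\<theta>, x). dens F \<theta> x) \<in> borel_measurable (restrict_space borel (param_space F) \<Otimes>\<^sub>M base F)"
    using F by (simp add: component_family_def)
  hence "(\<lambda>(\<theta>, x). dens F \<theta> x) \<in> borel_measurable (?R \<Otimes>\<^sub>M base F)"
    by (subst measurable_cong_sets[OF sets_pair_measure_cong[OF sets refl] refl])
  hence [measurable]: "(\<lambda>(x, \<theta>). dens F \<theta> x) \<in> borel_measurable (base F \<Otimes>\<^sub>M ?R)"
    by (subst (asm) measurable_pair_swap_iff) (simp add: case_prod_unfold)
  have "(\<lambda>x. \<integral>\<^sup>+\<theta>. ennreal (dens F \<theta> x * \<pi> \<theta>) \<partial>?R) \<in> borel_measurable (base F)"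
    by (rule R.borel_measurable_nn_integral) measurable
  thus ?thesis by (simp add: marginal_restrict_space[OF F])
qed

text \<open>By pigeonhole one part \<open>A ! l\<close> contains at least \<open>n / t\<close> observations.  The points of that part that
  cannot be split off cheaply lie in a thin slab: otherwise the hull of boundedly many of them contains a ball
  of measure at least \<open>V\<close>, and a quasi-concave density is at most \<open>1 / V\<close> at one of these points.
  Thin slabs have small probability, uniformly in position and direction.\<close>

theorem quasiconcave_inconsistent:
  fixes F :: "('p::euclidean_space, 'x::euclidean_space) family"
  assumes py: "py_params \<sigma> \<theta>\<^sub>0" and t: "t \<ge> 1" and N: "\<not> (\<sigma> < 0 \<and> \<theta>\<^sub>0 = real t * \<bar>\<sigma>\<bar>)"
    and cF: "component_family F" and opn: "open (space (base F))" and cvx: "convex (space (base F))"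
    and pos: "\<And>\<theta> x. \<theta> \<in> param_space F \<Longrightarrow> x \<in> space (base F) \<Longrightarrow> dens F \<theta> x > 0"
    and qc: "\<And>\<theta> r. \<theta> \<in> param_space F \<Longrightarrow> convex {x\<in>space (base F). r \<le> dens F \<theta> x}"
    and low: "\<And>K. compact K \<Longrightarrow> K \<subseteq> space (base F) \<Longrightarrow>
      \<exists>c>0. \<forall>B\<in>sets borel. B \<subseteq> K \<longrightarrow> ennreal c * emeasure lborel B \<le> emeasure (base F) B"
    and null: "\<And>B. B \<in> null_sets lborel \<Longrightarrow> B \<subseteq> space (base F) \<Longrightarrow> emeasure (base F) B = 0"
    and pw: "prior_weight F \<pi>" and fin: "finite_marginals F \<pi>" and iid: "iid_mixture M t F X"
  shows "AE \<omega> in M. limsup (\<lambda>n. ereal (posterior \<sigma> \<theta>\<^sub>0 F \<pi> n (\<lambda>j. X j \<omega>) t)) < 1"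
proof (cases "(\<integral>\<^sup>+\<theta>. ennreal (\<pi> \<theta>) \<partial>restrict_space lborel (param_space F)) = 0")
  case True
  show ?thesis
    by (intro AE_I2 limsup_less_oneI[of 0]) (simp_all add: posterior_zero_prior[OF cF pw t True])
next
  case nz: False
  define U where "U = space (base F)"
  obtain Q q \<theta> where M: "prob_space M" and ind: "prob_space.indep_vars M (\<lambda>_. base F) X {1..}"
    and dist: "\<And>j. j \<ge> 1 \<Longrightarrow> distr M (base F) (X j) = Q" and Q: "prob_space Q" and setsQ: "sets Q = sets (base F)"
    and q: "\<And>i. i \<in> {1..t} \<Longrightarrow> 0 \<le> q i \<and> \<theta> i \<in> param_space F" and q1: "(\<Sum>i=1..t. q i) = (1::real)"
    and mix: "\<And>B. B \<in> sets (base F) \<Longrightarrow> emeasure Q B = (\<Sum>i=1..t. ennreal (q i) * emeasure (component F (\<theta> i)) B)"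
    and Xsp: "\<And>j \<omega>. j \<ge> 1 \<Longrightarrow> \<omega> \<in> space M \<Longrightarrow> X j \<omega> \<in> space (base F)"
    by (rule iid_mixtureE[OF iid]) blast
  interpret prob_space M by fact
  interpret Q: prob_space Q by fact
  have spQ: "space Q = U" using sets_eq_imp_space_eq[OF setsQ] by (simp add: U_def)
  have sets_baseI: "B \<in> sets (base F)" if "B \<in> sets borel" "B \<subseteq> U" for B
  proof -
    have "sets (base F) = sets (restrict_space borel U)" using cF unfolding component_family_def U_def by blast
    thus ?thesis using that by (auto simp: sets_restrict_space)
  qed
  have Qnull: "measure Q B = 0" if B: "B \<in> null_sets lborel" "B \<subseteq> U" for B
  proof -
    have sB: "B \<in> sets (base F)" using B sets_baseI by auto
    have "emeasure (component F (\<theta> i)) B = 0" if "i \<in> {1..t}" for i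
    proof -
      have "absolutely_continuous (base F) (component F (\<theta> i))"
        unfolding component_def using component_familyD(5)[OF cF] q[OF that]
        by (intro absolutely_continuousI_density) auto
      moreover have "B \<in> null_sets (base F)" using null[OF B(1)] B sB by (auto simp: U_def)
      ultimately show ?thesis by (auto simp: absolutely_continuous_def null_sets_def)
    qed
    hence "emeasure Q B = 0" using mix[OF sB] by simp
    thus ?thesis by (simp add: measure_def)
  qed
  define m where "m x = enn2real (marginal F \<pi> (\<lambda>_. x) {0::nat})" for x
  have m_meas: "m \<in> borel_measurable Q"
    using marginal_measurable[OF cF pw] unfolding m_def
    by (subst measurable_cong_sets[OF setsQ refl]) measurable
  have m_pos: "m x > 0" if "x \<in> U" for x
  proof -
    have "marginal F \<pi> (\<lambda>_. x) {0::nat} > 0"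
      by (rule marginal_pos[OF cF pw nz]) (use that pos in \<open>auto simp: U_def\<close>)
    moreover have "marginal F \<pi> (\<lambda>_. x) {0::nat} < \<infinity>"
      using fin that unfolding finite_marginals_def U_def by simp
    ultimately show ?thesis by (simp add: m_def enn2real_positive_iff)
  qed
  \<comment> \<open>The largest part has at least \<open>n / t = 4 * \<beta> * n\<close> elements.
    At most \<open>\<beta> * n\<close> are lost outside \<open>G n0\<close> and at most
    \<open>\<beta> * n\<close> as expensive points, which leaves
    \<open>2 * \<beta> * n\<close>.\<close>
  define \<beta> where "\<beta> = 1 / (4 * real t)"
  have \<beta>: "\<beta> > 0" using t by (simp add: \<beta>_def)
  obtain C where C: "\<And>n. compact (C n)" "\<And>n. C n \<subseteq> U" "\<And>n. C n \<subseteq> interior (C (Suc n))" "\<Union>(range C) = U"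
    using open_Union_compact_subsets[OF opn] unfolding U_def by metis
  \<comment> \<open>On \<open>G n\<close> the data stay in a compact set and the single-point
    marginal is bounded below. These sets exhaust \<open>U\<close>, since that marginal is positive
    everywhere on \<open>U\<close>.\<close>
  define G where "G n = {x \<in> C n. inverse (real (Suc n)) \<le> m x}" for n
  have G_sets: "G n \<in> sets Q" for n
  proof -
    have "C n \<in> sets Q" unfolding setsQ using C by (intro sets_baseI borel_compact) auto
    moreover have "G n = C n \<inter> {x\<in>space Q. inverse (real (Suc n)) \<le> m x}"
      using C(2)[of n] by (auto simp: G_def spQ)
    moreover have "{x\<in>space Q. inverse (real (Suc n)) \<le> m x} \<in> sets Q" using m_meas by measurable
    ultimately show ?thesis by auto
  qed
  have C_mono: "C n \<subseteq> C (Suc n)" for n using C(3)[of n] interior_subset by blast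
  have "(\<lambda>n. measure Q (U - G n)) \<longlonglongrightarrow> measure Q (\<Inter>n. U - G n)"
  proof (rule Q.finite_Lim_measure_decseq)
    show "range (\<lambda>n. U - G n) \<subseteq> sets Q" using G_sets spQ by auto
    show "decseq (\<lambda>n. U - G n)"
    proof (rule decseq_SucI)
      fix n
      have le: "inverse (real (Suc (Suc n))) \<le> inverse (real (Suc n))" by (intro le_imp_inverse_le) auto
      show "U - G (Suc n) \<subseteq> U - G n"
        using C_mono[of n] order_trans[OF le] unfolding G_def by blast
    qed
  qed
  also have "(\<Inter>n. U - G n) = {}"
  proof -
    have "\<exists>n. x \<in> G n" if x: "x \<in> U" for x
    proof -
      obtain n1 where n1: "x \<in> C n1" using x C(4) by blast
      obtain n2 where n2: "inverse (real (Suc n2)) < m x" using reals_Archimedean[OF m_pos[OF x]] by blast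
      have "C n1 \<subseteq> C (max n1 n2)" by (rule lift_Suc_mono_le[of C, OF C_mono]) simp
      moreover have "inverse (real (Suc (max n1 n2))) \<le> inverse (real (Suc n2))"
        by (intro le_imp_inverse_le) auto
      hence "inverse (real (Suc (max n1 n2))) \<le> m x" using n2 by linarith
      ultimately have "x \<in> G (max n1 n2)" unfolding G_def using n1 by blast
      thus ?thesis ..
    qed
    thus ?thesis by blast
  qed
  finally have "eventually (\<lambda>n. measure Q (U - G n) < \<beta>) sequentially"
    using \<beta> by (intro order_tendstoD(2)) auto
  then obtain n0 where n0: "measure Q (U - G n0) < \<beta>" by (auto simp: eventually_sequentially)
  define K where "K = C n0"
  define m0 where "m0 = inverse (real (Suc n0))"
  have m0: "m0 > 0" by (simp add: m0_def)
  have G0: "G n0 = {x\<in>K. m0 \<le> m x}" by (simp add: G_def K_def m0_def)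
  have K: "compact K" "K \<subseteq> U" using C by (simp_all add: K_def)
  have hyper: "measure Q (K \<inter> {x. u \<bullet> x = c}) = 0" if "norm u = 1" for u :: 'x and c
  proof -
    have "u \<noteq> 0" using that by auto
    have "{x. u \<bullet> x = c} \<in> null_sets lborel"
    proof -
      have "{x. u \<bullet> x = c} \<in> sets borel" by (intro borel_closed closed_hyperplane)
      moreover have "negligible {x. u \<bullet> x = c}" using \<open>u \<noteq> 0\<close> by (intro negligible_hyperplane) simp
      ultimately show ?thesis using null_sets_completion_iff[of "{x. u \<bullet> x = c}" lborel] by (simp add: negligible_iff_null_sets)
    qed
    moreover have "K \<in> sets lborel" using K by (simp add: borel_compact)
    ultimately have "K \<inter> {x. u \<bullet> x = c} \<in> null_sets lborel" by (rule null_set_Int1)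
    thus ?thesis using K(2) by (intro Qnull) auto
  qed
  obtain \<delta> \<F> where \<delta>: "\<delta> > 0" and \<F>: "finite \<F>" "\<F> \<subseteq> sets Q" "\<And>E. E \<in> \<F> \<Longrightarrow> measure Q E < \<beta>"
    and cover: "\<And>u c. norm u = 1 \<Longrightarrow> \<exists>E\<in>\<F>. {x\<in>K. \<bar>u \<bullet> x - c\<bar> \<le> \<delta>} \<subseteq> E"
  proof (rule slab_cover[OF Q K(1) _ hyper \<beta>])
    show "K \<inter> B \<in> sets Q" if "B \<in> sets borel" for B
      unfolding setsQ using that K borel_compact[OF K(1)] by (intro sets_baseI sets.Int) auto
  qed blast+
  \<comment> \<open>Replacing a point by its neighbour in the net changes its height by at most
    \<open>\<delta> / 2\<close>, so the net still leaves every slab of half-width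
    \<open>\<delta> / 2\<close>.\<close>
  obtain M0 where M0: "\<And>B (x :: nat \<Rightarrow> 'x). x ` B \<subseteq> K \<Longrightarrow>
      \<exists>T\<subseteq>B. finite T \<and> card T \<le> M0 \<and> (\<forall>j\<in>B. \<exists>i\<in>T. dist (x i) (x j) \<le> \<delta> / 2)"
    using compact_index_net[OF K(1), of "\<delta> / 2"] \<delta> by (auto simp del: ex_simps all_simps)
  \<comment> \<open>The ball that is found lies in the hull of points of \<open>K\<close> and
    possibly not in \<open>K\<close>, so the base measure has to be bounded below on the
    hull.\<close>
  define K' where "K' = convex hull K"
  have K': "compact K'" "K' \<subseteq> U"
    unfolding K'_def using K cvx by (simp_all add: compact_convex_hull U_def subset_hull)
  obtain c0 where c0: "c0 > 0" "\<And>B. B \<in> sets borel \<Longrightarrow> B \<subseteq> K' \<Longrightarrow> ennreal c0 * emeasure lborel B \<le> emeasure (base F) B"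
    using low[OF K'(1)] K'(2) unfolding U_def by blast
  \<comment> \<open>The radius from \<open>ball_subset_convex_hull\<close> for width
    \<open>\<delta> / 2\<close>; \<open>Suc M0\<close> rules out a division by zero.\<close>
  define r where "r = \<delta> / 2 / real (Suc M0)"
  have r: "r > 0" using \<delta> by (simp add: r_def)
  define V where "V = c0 * (unit_ball_vol (real DIM('x)) * r ^ DIM('x))"
  have V: "V > 0" unfolding V_def using c0 r by (intro mult_pos_pos) auto
  \<comment> \<open>The factor \<open>Suc M0 / V\<close> is the price of removing a point from its
    part, and \<open>1 / m0\<close> compensates for the marginal of that point alone.\<close>
  define c where "c = real (Suc M0) / (V * m0)"
  have c: "c > 0" unfolding c_def using V m0 by simp
  \<comment> \<open>The finitely many sets are fixed before the data are seen, so one null event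
    serves all slabs, even those chosen depending on the data.\<close>
  have "AE \<omega> in M. \<forall>E\<in>insert (U - G n0) \<F>.
      eventually (\<lambda>n. real (card {j\<in>{1..n}. X j \<omega> \<in> E}) \<le> \<beta> * real n) sequentially"
  proof (rule AE_finite_allI)
    fix E assume E: "E \<in> insert (U - G n0) \<F>"
    show "AE \<omega> in M. eventually (\<lambda>n. real (card {j\<in>{1..n}. X j \<omega> \<in> E}) \<le> \<beta> * real n) sequentially"
    proof (rule AE_eventually_card_le[OF ind dist])
      have "U - G n0 \<in> sets Q" using G_sets spQ by auto
      thus "E \<in> sets (base F)" using E \<F>(2) by (auto simp: setsQ)
      show "measure Q E < \<beta>" using E \<F>(3) n0 by auto
    qed
  qed (use \<F> in simp)
  thus ?thesis
  proof (rule AE_mp, intro AE_I2 impI)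
    fix \<omega> assume \<omega>: "\<omega> \<in> space M" and ev: "\<forall>E\<in>insert (U - G n0) \<F>.
      eventually (\<lambda>n. real (card {j\<in>{1..n}. X j \<omega> \<in> E}) \<le> \<beta> * real n) sequentially"
    define x where "x j = X j \<omega>" for j
    define mu where "mu J = enn2real (marginal F \<pi> x J)" for J
    have xU: "x j \<in> U" if "j \<ge> 1" for j using Xsp[OF that \<omega>] by (simp add: x_def U_def)
    have mu_single: "mu {j} = m (x j)" for j by (simp add: mu_def m_def marginal_def)
    have mu0: "mu J \<ge> 0" for J by (simp add: mu_def)
    have ev': "eventually (\<lambda>n. \<forall>E\<in>insert (U - G n0) \<F>. real (card {j\<in>{1..n}. x j \<in> E}) \<le> \<beta> * real n) sequentially"
      using ev \<F>(1) unfolding x_def by (intro eventually_ball_finite) auto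
    have "limsup (\<lambda>n. ereal (posterior \<sigma> \<theta>\<^sub>0 F \<pi> n x t)) < 1"
    proof (rule posterior_limsup_less_one[OF py t N, of c "2 * \<beta>"])
      show "eventually (\<lambda>n. \<forall>A\<in>ordered_partitions t n. (2 * \<beta>) * real n \<le> card {j. \<exists>l<t. j \<in> A ! l \<and>
        enn2real (marginal F \<pi> x (A ! l)) \<le> c * enn2real (marginal F \<pi> x (A ! l - {j})) *
          enn2real (marginal F \<pi> x {j})}) sequentially"
        using ev' eventually_ge_at_top[of "2 * t"] unfolding mu_def[symmetric]
      proof eventually_elim
        case (elim n)
        have cnt: "real (card {j\<in>{1..n}. x j \<in> E}) \<le> \<beta> * real n" if "E \<in> insert (U - G n0) \<F>" for E
          using elim(1) that by blast
        have n: "n > 0" "real n \<ge> 2 * real t" using elim(2) t by auto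
        show ?case
        proof
          fix A assume A: "A \<in> ordered_partitions t n"
          let ?S = "{j. \<exists>l<t. j \<in> A ! l \<and> mu (A ! l) \<le> c * mu (A ! l - {j}) * mu {j}}"
          have un: "(\<Union>l<t. A ! l) = {1..n}" using A by (simp add: ordered_partitions_def)
          have "?S \<subseteq> {1..n}" using un by blast
          hence fS: "finite ?S" using finite_subset by blast
          obtain l where l: "l < t" "real (card (A ! l)) \<ge> real n / real t"
          proof (rule ccontr)
            assume *: "\<not> thesis"
            have "n = card (\<Union>l<t. A ! l)" using un by simp
            also have "\<dots> \<le> (\<Sum>l<t. card (A ! l))" by (rule card_UN_le) simp
            finally have "real n \<le> (\<Sum>l<t. real (card (A ! l)))" by (metis of_nat_le_iff of_nat_sum)
            also have "\<dots> < (\<Sum>l<t. real n / real t)"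
              using * that t by (intro sum_strict_mono) (auto simp: not_le[symmetric] lessThan_empty_iff)
            also have "\<dots> = real n" using t by simp
            finally show False by simp
          qed
          define J where "J = A ! l"
          have J: "J \<subseteq> {1..n}" using un l by (auto simp: J_def)
          have fJ: "finite J" by (rule finite_subset[OF J]) simp
          have cJ: "real (card J) \<ge> 4 * \<beta> * real n" using l(2) by (simp add: J_def \<beta>_def)
          have J2: "card J \<ge> 2"
          proof -
            have "2 \<le> real n / real t" using n t by (simp add: field_simps)
            hence "2 \<le> real (card J)" using l(2) by (simp add: J_def)
            thus ?thesis by linarith
          qed
          define B where "B = {j\<in>J. x j \<in> G n0 \<and> \<not> mu J \<le> c * mu (J - {j}) * mu {j}}"
          have cB: "real (card B) \<le> \<beta> * real n"
          proof (rule ccontr)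
            assume B: "\<not> ?thesis"
            have BJ: "B \<subseteq> J" by (auto simp: B_def)
            have xB: "x ` B \<subseteq> K" by (auto simp: B_def G0)
            \<comment> \<open>A slab containing \<open>B\<close> would put more than
              \<open>\<beta> * n\<close> observations into one of the sets of
              \<open>\<F>\<close>.\<close>
            have wide: "\<exists>j\<in>B. \<bar>u \<bullet> x j - d\<bar> > \<delta>" if u: "norm u = 1" for u d
            proof (rule ccontr)
              assume "\<not> ?thesis"
              hence slab: "\<And>j. j \<in> B \<Longrightarrow> \<bar>u \<bullet> x j - d\<bar> \<le> \<delta>" by force
              obtain E where E: "E \<in> \<F>" "{x\<in>K. \<bar>u \<bullet> x - d\<bar> \<le> \<delta>} \<subseteq> E" using cover[OF u] by blast
              have "B \<subseteq> {j\<in>{1..n}. x j \<in> E}" using slab E(2) xB BJ J by blast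
              hence "card B \<le> card {j\<in>{1..n}. x j \<in> E}" by (intro card_mono) auto
              thus False using cnt[of E] E(1) B by simp
            qed
            obtain T where T: "T \<subseteq> B" "finite T" "card T \<le> M0"
              and net: "\<And>j. j \<in> B \<Longrightarrow> \<exists>i\<in>T. dist (x i) (x j) \<le> \<delta> / 2"
              using M0[OF xB] by blast
            have "\<beta> * real n \<ge> 0" using \<beta> by simp
            hence "B \<noteq> {}" using B by auto
            hence T0: "T \<noteq> {}" using net by blast
            have "\<exists>z. ball z (\<delta> / 2 / real (Suc M0)) \<subseteq> convex hull (x ` T)"
            proof (rule ball_subset_convex_hull)
              show "card (x ` T) \<le> Suc M0" using card_image_le[OF T(2), of x] T(3) by linarith
              fix u :: 'x and d assume u: "norm u = 1"
              obtain j where j: "j \<in> B" "\<bar>u \<bullet> x j - d\<bar> > \<delta>" using wide[OF u] by blast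
              obtain i where i: "i \<in> T" "dist (x i) (x j) \<le> \<delta> / 2" using net[OF j(1)] by blast
              have "\<bar>u \<bullet> (x i - x j)\<bar> \<le> \<delta> / 2"
                using Cauchy_Schwarz_ineq2[of u "x i - x j"] u i(2) by (simp add: dist_norm)
              hence "\<bar>u \<bullet> x i - d\<bar> > \<delta> / 2" using j(2) unfolding inner_diff_right by linarith
              thus "\<exists>y\<in>x ` T. \<bar>u \<bullet> y - d\<bar> > \<delta> / 2" using i by blast
            qed (use T T0 \<delta> in auto)
            then obtain z where z: "ball z r \<subseteq> convex hull (x ` T)" unfolding r_def by blast
            have "x ` T \<subseteq> K" using T xB by blast
            hence "ball z r \<subseteq> K'" using z hull_mono[of "x ` T" K convex] by (auto simp: K'_def)
            have "ennreal V = ennreal c0 * emeasure lborel (ball z r)"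
              using c0 r by (simp add: V_def emeasure_ball ennreal_mult)
            also have "\<dots> \<le> emeasure (base F) (ball z r)" by (rule c0) (use \<open>ball z r \<subseteq> K'\<close> in auto)
            finally have Vball: "ennreal V \<le> emeasure (base F) (ball z r)" .
            have "\<exists>j\<in>T. V * mu J \<le> real (Suc M0) * mu (J - {j})"
              unfolding mu_def
            proof (rule marginal_remove_point[OF cF pw fin _ fJ J2 _ T0 _ V])
              show "x j \<in> space (base F)" if "j \<in> J" for j using xU[of j] J that by (auto simp: U_def)
              show "T \<subseteq> J" using T BJ by blast
              fix \<eta> assume \<eta>: "\<eta> \<in> param_space F"
              have "\<exists>y\<in>x ` T. dens F \<eta> y \<le> 1 / V"
              proof (rule quasiconcave_density_min_le[OF cF \<eta> qc[OF \<eta>] _ _ _ _ z Vball V])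
                show "x ` T \<subseteq> space (base F)" using \<open>x ` T \<subseteq> K\<close> K(2) by (simp add: U_def)
                show "ball z r \<in> sets (base F)" using \<open>ball z r \<subseteq> K'\<close> K'(2) by (intro sets_baseI) auto
              qed (use T T0 in auto)
              thus "\<exists>j\<in>T. dens F \<eta> (x j) \<le> 1 / V" by blast
            qed (use T in auto)
            then obtain j where j: "j \<in> T" "V * mu J \<le> real (Suc M0) * mu (J - {j})" by blast
            have "j \<in> B" using j T by blast
            hence mj: "m0 \<le> mu {j}" by (simp add: B_def G0 mu_single)
            have "mu J \<le> real (Suc M0) / V * mu (J - {j})" using j(2) V by (simp add: field_simps)
            also have "\<dots> = c * mu (J - {j}) * m0" using m0 V by (simp add: c_def field_simps)
            also have "\<dots> \<le> c * mu (J - {j}) * mu {j}" using mj c mu0 by (intro mult_left_mono) auto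
            finally show False using \<open>j \<in> B\<close> by (simp add: B_def)
          qed
          let ?D = "{j\<in>{1..n}. x j \<in> U - G n0}"
          have "J \<subseteq> ?S \<union> B \<union> ?D"
            using l(1) J xU by (auto simp: B_def J_def[symmetric] intro!: exI[of _ l])
          hence "card J \<le> card (?S \<union> B \<union> ?D)"
            using fS fJ by (intro card_mono) (auto simp: B_def)
          also have "\<dots> \<le> card (?S \<union> B) + card ?D" by (rule card_Un_le)
          also have "card (?S \<union> B) \<le> card ?S + card B" by (rule card_Un_le)
          finally have "real (card J) \<le> real (card ?S) + real (card B) + real (card ?D)" by linarith
          thus "(2 * \<beta>) * real n \<le> real (card ?S)" using cJ cB cnt[of "U - G n0"] by simp
        qed
      qed
    qed (use \<beta> c in auto)
    thus "limsup (\<lambda>n. ereal (posterior \<sigma> \<theta>\<^sub>0 F \<pi> n (\<lambda>j. X j \<omega>) t)) < 1" unfolding x_def .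
  qed
qed

section \<open>Conjugate exponential families\<close>

text \<open>Collects what \<open>quasiconcave_inconsistent\<close> asks of the base measure. Being
  nonempty and open makes the space non-null, so that exponential densities can be
  normalised.\<close>

definition regular_base :: "'x::euclidean_space measure \<Rightarrow> bool" where
  "regular_base L \<longleftrightarrow> sigma_finite_measure L \<and> sets L = sets (restrict_space borel (space L)) \<and>
    open (space L) \<and> convex (space L) \<and> space L \<noteq> {} \<and>
    (\<forall>K. compact K \<longrightarrow> K \<subseteq> space L \<longrightarrow>
      (\<exists>c>0. \<forall>B\<in>sets borel. B \<subseteq> K \<longrightarrow> ennreal c * emeasure lborel B \<le> emeasure L B)) \<and>
    (\<forall>B\<in>null_sets lborel. B \<subseteq> space L \<longrightarrow> emeasure L B = 0)"

lemma exp_inner_measurable: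
  fixes L :: "'x::euclidean_space measure" and s :: "'x \<Rightarrow> 'p::euclidean_space"
  assumes [measurable]: "s \<in> borel_measurable L"
  shows "(\<lambda>(\<theta>, x). exp (\<theta> \<bullet> s x)) \<in> borel_measurable (borel \<Otimes>\<^sub>M L)"
  by measurable

lemma natural_params_measurable:
  fixes L :: "'x::euclidean_space measure" and s :: "'x \<Rightarrow> 'p::euclidean_space"
  assumes L: "sigma_finite_measure L" and s: "s \<in> borel_measurable L"
  shows "natural_params L s \<in> sets borel" and "log_partition L s \<in> borel_measurable borel"
proof -
  interpret sigma_finite_measure L by fact
  note [measurable] = exp_inner_measurable[OF s]
  have "(\<lambda>\<theta>. \<integral>\<^sup>+x. ennreal (exp (\<theta> \<bullet> s x)) \<partial>L) \<in> borel_measurable borel"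
    by (rule borel_measurable_nn_integral) measurable
  hence "{\<theta>\<in>space borel. (\<integral>\<^sup>+x. ennreal (exp (\<theta> \<bullet> s x)) \<partial>L) < \<infinity>} \<in> sets borel" by measurable
  thus "natural_params L s \<in> sets borel" by (simp add: natural_params_def)
  have "(\<lambda>\<theta>. \<integral>x. exp (\<theta> \<bullet> s x) \<partial>L) \<in> borel_measurable borel"
    by (rule borel_measurable_lebesgue_integral) measurable
  thus "log_partition L s \<in> borel_measurable borel" unfolding log_partition_def by measurable
qed

lemma regular_base_nonnull:
  assumes "regular_base L" shows "emeasure L (space L) \<noteq> 0"
proof -
  obtain x where "x \<in> space L" using assms by (auto simp: regular_base_def)
  then obtain e where e: "e > 0" "cball x e \<subseteq> space L"
    using assms open_contains_cball unfolding regular_base_def by metis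
  then obtain c where c: "c > 0" "\<And>B. B \<in> sets borel \<Longrightarrow> B \<subseteq> cball x e \<Longrightarrow> ennreal c * emeasure lborel B \<le> emeasure L B"
    using assms compact_cball unfolding regular_base_def by metis
  have "0 < ennreal c * emeasure lborel (ball x e)"
    using c e by (simp add: emeasure_ball ennreal_zero_less_mult_iff)
  also have "\<dots> \<le> emeasure L (ball x e)" by (rule c) auto
  also have "\<dots> \<le> emeasure L (space L)" by (rule emeasure_space)
  finally show ?thesis by simp
qed

lemma component_family_exp_family:
  fixes L :: "'x::euclidean_space measure" and s :: "'x \<Rightarrow> 'p::euclidean_space"
  assumes L: "regular_base L" and s: "s \<in> borel_measurable L"
  shows "component_family (exp_family L s)"
proof -
  have sf: "sigma_finite_measure L" using L by (simp add: regular_base_def)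
  have [measurable]: "s \<in> borel_measurable L" by (rule s)
  have [measurable]: "log_partition L s \<in> borel_measurable borel" by (rule natural_params_measurable[OF sf s])
  let ?R = "restrict_space borel (natural_params L s)"
  have id: "(\<lambda>x. x) \<in> measurable ?R borel" by (intro measurable_restrict_space1) simp
  have [measurable]: "log_partition L s \<in> borel_measurable ?R" by (intro measurable_restrict_space1) simp
  have joint: "(\<lambda>(\<theta>, x). exp (\<theta> \<bullet> s x - log_partition L s \<theta>)) \<in> borel_measurable (?R \<Otimes>\<^sub>M L)"
    using id by measurable
  have int: "(\<integral>\<^sup>+x. ennreal (exp (\<theta> \<bullet> s x - log_partition L s \<theta>)) \<partial>L) = 1" if "\<theta> \<in> natural_params L s" for \<theta>
  proof -
    have lt: "(\<integral>\<^sup>+x. ennreal (exp (\<theta> \<bullet> s x)) \<partial>L) < \<infinity>" using that by (simp add: natural_params_def)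
    define I where "I = (\<integral>x. exp (\<theta> \<bullet> s x) \<partial>L)"
    \<comment> \<open>\<open>log_partition\<close> is built from the Bochner integral, which is 0 by
      convention when it diverges; on the natural parameters it agrees with the nonnegative
      integral.\<close>
    have nn: "(\<integral>\<^sup>+x. ennreal (exp (\<theta> \<bullet> s x)) \<partial>L) = ennreal I"
      unfolding I_def using lt by (intro nn_integral_eq_integral integrableI_nonneg) auto
    have "(\<integral>\<^sup>+x. ennreal (exp (\<theta> \<bullet> s x)) \<partial>L) \<noteq> 0"
    proof
      assume "(\<integral>\<^sup>+x. ennreal (exp (\<theta> \<bullet> s x)) \<partial>L) = 0"
      hence "AE x in L. False" by (subst (asm) nn_integral_0_iff_AE) auto
      hence "emeasure L (space L) = 0" by (simp add: AE_iff_null null_sets_def)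
      thus False using regular_base_nonnull[OF L] by simp
    qed
    hence I: "I > 0" using nn by (auto simp: ennreal_eq_0_iff not_le)
    have "(\<integral>\<^sup>+x. ennreal (exp (\<theta> \<bullet> s x - log_partition L s \<theta>)) \<partial>L) =
        (\<integral>\<^sup>+x. ennreal (1 / I) * ennreal (exp (\<theta> \<bullet> s x)) \<partial>L)"
      using I by (intro nn_integral_cong)
        (simp add: log_partition_def I_def[symmetric] exp_diff flip: ennreal_mult)
    also have "\<dots> = ennreal (1 / I) * ennreal I" by (subst nn_integral_cmult) (auto simp: nn)
    also have "\<dots> = 1" using I by (simp flip: ennreal_mult)
    finally show ?thesis .
  qed
  show ?thesis
    using L joint int natural_params_measurable[OF sf s]
    by (simp add: component_family_def exp_family_def regular_base_def)
qed

lemma prior_weight_conj_prior: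
  fixes L :: "'x::euclidean_space measure" and s :: "'x \<Rightarrow> 'p::euclidean_space"
  assumes L: "regular_base L" and s: "s \<in> borel_measurable L"
  shows "prior_weight (exp_family L s) (conj_prior L s \<xi> \<nu>)"
proof -
  have sf: "sigma_finite_measure L" using L by (simp add: regular_base_def)
  note [measurable] = natural_params_measurable[OF sf s]
  have "conj_prior L s \<xi> \<nu> \<in> borel_measurable borel" unfolding conj_prior_def by measurable
  thus ?thesis by (auto simp: prior_weight_def exp_family_def conj_prior_def intro: measurable_restrict_space1)
qed

text \<open>Since exp is increasing and \<open>log_partition\<close> does not depend on
  \<open>x\<close>, the superlevel sets of the densities are those of the linear statistic, or the
  whole space for nonpositive levels.\<close>

theorem exp_family_inconsistent:
  fixes L :: "'x::euclidean_space measure" and s :: "'x \<Rightarrow> 'p::euclidean_space"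
  assumes py: "py_params \<sigma> \<theta>\<^sub>0" and t: "t \<ge> 1" and N: "\<not> (\<sigma> < 0 \<and> \<theta>\<^sub>0 = real t * \<bar>\<sigma>\<bar>)"
    and L: "regular_base L" and s: "s \<in> borel_measurable L"
    and qc: "\<And>\<theta> r. \<theta> \<in> natural_params L s \<Longrightarrow> convex {x\<in>space L. r \<le> \<theta> \<bullet> s x}"
    and fin: "finite_marginals (exp_family L s) (conj_prior L s \<xi> \<nu>)" and iid: "iid_mixture M t (exp_family L s) X"
  shows "AE \<omega> in M. \<not> consistent_for \<sigma> \<theta>\<^sub>0 (exp_family L s) (conj_prior L s \<xi> \<nu>) (\<lambda>j. X j \<omega>) t \<and>
    limsup (\<lambda>n. ereal (posterior \<sigma> \<theta>\<^sub>0 (exp_family L s) (conj_prior L s \<xi> \<nu>) n (\<lambda>j. X j \<omega>) t)) < 1"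
proof -
  have "AE \<omega> in M. limsup (\<lambda>n. ereal (posterior \<sigma> \<theta>\<^sub>0 (exp_family L s) (conj_prior L s \<xi> \<nu>) n (\<lambda>j. X j \<omega>) t)) < 1"
  proof (rule quasiconcave_inconsistent[OF py t N component_family_exp_family[OF L s] _ _ _ _ _ _
        prior_weight_conj_prior[OF L s] fin iid])
    fix \<theta> r assume "\<theta> \<in> param_space (exp_family L s)"
    hence \<theta>: "\<theta> \<in> natural_params L s" by (simp add: exp_family_def)
    show "convex {x \<in> space (base (exp_family L s)). r \<le> dens (exp_family L s) \<theta> x}"
    proof (cases "r > 0")
      case True
      have "r \<le> exp u \<longleftrightarrow> ln r \<le> u" for u using True by (metis exp_le_cancel_iff exp_ln)
      hence "r \<le> dens (exp_family L s) \<theta> x \<longleftrightarrow> ln r + log_partition L s \<theta> \<le> \<theta> \<bullet> s x" for x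
        by (simp add: exp_family_def algebra_simps)
      thus ?thesis using qc[OF \<theta>, of "ln r + log_partition L s \<theta>"] by (simp add: exp_family_def)
    next
      case False
      hence "{x \<in> space (base (exp_family L s)). r \<le> dens (exp_family L s) \<theta> x} = space L"
        by (auto simp: exp_family_def intro: order_trans[OF _ exp_ge_zero])
      thus ?thesis using L by (simp add: regular_base_def)
    qed
  qed (use L in \<open>auto simp: regular_base_def exp_family_def\<close>)
  thus ?thesis by (rule AE_mp) (auto intro!: AE_I2 not_consistent_if_limsup_less_one)
qed

section \<open>The concrete base measures\<close>

lemma regular_base_lborel: "regular_base (lborel :: 'x::euclidean_space measure)"
  unfolding regular_base_def
  by (auto intro!: exI[of _ 1] sigma_finite_lborel simp: sets_restrict_space)

text \<open>A continuous positive density attains a positive minimum on each compact set, which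
  serves as the local comparison constant with Lebesgue measure.\<close>

lemma regular_base_density_pos:
  fixes g :: "real \<Rightarrow> real"
  assumes cont: "continuous_on {0<..} g" and pos: "\<And>x. x > 0 \<Longrightarrow> g x > 0"
  shows "regular_base (density pos_lborel (\<lambda>x. ennreal (g x)))"
proof -
  have sp: "space pos_lborel = {0<..}" by (simp add: pos_lborel_def space_restrict_space)
  have sets: "sets pos_lborel = sets (restrict_space borel {0<..})" by (simp add: pos_lborel_def sets_restrict_space)
  have "g \<in> borel_measurable (restrict_space borel {0<..})" by (rule borel_measurable_continuous_on_restrict[OF cont])
  hence [measurable]: "g \<in> borel_measurable pos_lborel" by (subst measurable_cong_sets[OF sets refl])
  have sf: "sigma_finite_measure pos_lborel"
    unfolding pos_lborel_def by (intro sigma_finite_measure_restrict_space sigma_finite_lborel) simp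
  have em: "emeasure pos_lborel B = emeasure lborel B" if "B \<subseteq> {0<..}" for B
    unfolding pos_lborel_def using that by (intro emeasure_restrict_space) auto
  have setI: "B \<in> sets pos_lborel" if "B \<in> sets borel" "B \<subseteq> {0<..}" for B
    using that by (auto simp: sets sets_restrict_space)
  have sfd: "sigma_finite_measure (density pos_lborel (\<lambda>x. ennreal (g x)))"
    by (subst sigma_finite_measure.sigma_finite_iff_density_finite[OF sf]) auto
  have low: "\<exists>c>0. \<forall>B\<in>sets borel. B \<subseteq> K \<longrightarrow>
      ennreal c * emeasure lborel B \<le> emeasure (density pos_lborel (\<lambda>x. ennreal (g x))) B"
    if K: "compact K" "K \<subseteq> {0<..}" for K
  proof (cases "K = {}")
    case False
    obtain x0 where x0: "x0 \<in> K" "\<And>x. x \<in> K \<Longrightarrow> g x0 \<le> g x"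
      using continuous_attains_inf[OF K(1) False continuous_on_subset[OF cont K(2)]] by blast
    show ?thesis
    proof (intro exI[of _ "g x0"] conjI ballI impI)
      show "g x0 > 0" using pos x0 K by auto
      fix B assume B: "B \<in> sets borel" "B \<subseteq> K"
      have BK: "B \<subseteq> {0<..}" using B K by blast
      have "ennreal (g x0) * emeasure lborel B = (\<integral>\<^sup>+x. ennreal (g x0) * indicator B x \<partial>pos_lborel)"
        using setI[OF B(1) BK] by (simp add: nn_integral_cmult_indicator em[OF BK])
      also have "\<dots> \<le> (\<integral>\<^sup>+x. ennreal (g x) * indicator B x \<partial>pos_lborel)"
        using x0 B by (intro nn_integral_mono) (auto simp: indicator_def intro!: ennreal_leI)
      also have "\<dots> = emeasure (density pos_lborel (\<lambda>x. ennreal (g x))) B"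
        using setI[OF B(1) BK] by (simp add: emeasure_density)
      finally show "ennreal (g x0) * emeasure lborel B \<le> emeasure (density pos_lborel (\<lambda>x. ennreal (g x))) B" .
    qed
  qed (auto intro!: exI[of _ 1])
  have null: "emeasure (density pos_lborel (\<lambda>x. ennreal (g x))) B = 0" if "B \<in> null_sets lborel" "B \<subseteq> {0<..}" for B
  proof -
    have "absolutely_continuous pos_lborel (density pos_lborel (\<lambda>x. ennreal (g x)))"
      by (rule absolutely_continuousI_density) simp
    moreover have "B \<in> null_sets pos_lborel" using that setI[of B] em[of B] by (simp add: null_sets_def)
    ultimately show ?thesis by (auto simp: absolutely_continuous_def null_sets_def)
  qed
  show ?thesis
    unfolding regular_base_def using sfd low null by (auto simp: sp sets)
qed

lemma regular_base_pos_lborel: "regular_base pos_lborel"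
  using regular_base_density_pos[of "\<lambda>_. 1"] by (simp add: density_1)

lemma regular_base_weibull: "regular_base (weibull_base a)"
  unfolding weibull_base_def by (rule regular_base_density_pos) (auto intro!: continuous_intros)

section \<open>Superlevel sets of the log-densities on the half-line\<close>

lemma convex_superlevel_real:
  fixes f :: "real \<Rightarrow> real"
  assumes "\<And>x y z. 0 < x \<Longrightarrow> x < z \<Longrightarrow> z < y \<Longrightarrow> f z < f x \<Longrightarrow> f z < f y \<Longrightarrow> False"
  shows "convex {x\<in>{0<..}. r \<le> f x}"
proof -
  \<comment> \<open>Convex sets of reals are intervals, so only a strict valley of \<open>f\<close>
    between two points could break convexity.\<close>
  have "is_interval {x\<in>{0<..}. r \<le> f x}"
    unfolding is_interval_1
  proof (intro ballI allI impI)
    fix x y z assume *: "x \<in> {x \<in> {0<..}. r \<le> f x}" "y \<in> {x \<in> {0<..}. r \<le> f x}" "x \<le> z \<and> z \<le> y"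
    have "r \<le> f z"
    proof (cases "z = x \<or> z = y")
      case False
      thus ?thesis using assms[of x z y] * by force
    qed (use * in auto)
    thus "z \<in> {x \<in> {0<..}. r \<le> f x}" using * by auto
  qed
  thus ?thesis by (simp only: is_interval_convex_1)
qed

text \<open>The integrand is at least 1 on a whole half-line, so its integral diverges. This rules
  out parameters with the wrong sign of the leading coefficient.\<close>

lemma not_natural_paramI:
  fixes s :: "real \<Rightarrow> 'p::euclidean_space"
  assumes "eventually (\<lambda>x. \<theta> \<bullet> s x \<ge> 0) at_top"
  shows "\<theta> \<notin> natural_params pos_lborel s"
proof
  assume "\<theta> \<in> natural_params pos_lborel s"
  hence fin: "(\<integral>\<^sup>+x. ennreal (exp (\<theta> \<bullet> s x)) \<partial>pos_lborel) < \<infinity>" by (simp add: natural_params_def)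
  define I where "I = enn2real (\<integral>\<^sup>+x. ennreal (exp (\<theta> \<bullet> s x)) \<partial>pos_lborel)"
  have I: "(\<integral>\<^sup>+x. ennreal (exp (\<theta> \<bullet> s x)) \<partial>pos_lborel) = ennreal I" using fin by (simp add: I_def)
  obtain x0 where x0: "\<And>x. x \<ge> x0 \<Longrightarrow> \<theta> \<bullet> s x \<ge> 0" using assms by (auto simp: eventually_at_top_linorder)
  define a where "a = max 1 x0"
  \<comment> \<open>The interval has length \<open>I + 1\<close>, more than the supposed value of
    the integral.\<close>
  define b where "b = a + I + 1"
  have I0: "I \<ge> 0" by (simp add: I_def)
  have ab: "{a..b} \<subseteq> {0<..}" by (auto simp: a_def)
  have "ennreal (I + 1) = emeasure lborel {a..b}" using I0 by (simp add: b_def)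
  also have "\<dots> = emeasure pos_lborel {a..b}"
    unfolding pos_lborel_def using ab by (intro emeasure_restrict_space[symmetric]) auto
  also have "\<dots> = (\<integral>\<^sup>+x. indicator {a..b} x \<partial>pos_lborel)"
    using ab by (intro nn_integral_indicator[symmetric]) (auto simp: pos_lborel_def sets_restrict_space)
  also have "\<dots> \<le> (\<integral>\<^sup>+x. ennreal (exp (\<theta> \<bullet> s x)) \<partial>pos_lborel)"
    using x0 by (intro nn_integral_mono) (auto simp: indicator_def a_def)
  finally show False unfolding I using I0 by simp
qed

lemma exponential_superlevel: "convex {x\<in>{0<..}. r \<le> \<theta> \<bullet> x}" for \<theta> :: real
proof (rule convex_superlevel_real)
  fix x y z :: real assume "x < z" "z < y" "\<theta> \<bullet> z < \<theta> \<bullet> x" "\<theta> \<bullet> z < \<theta> \<bullet> y"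
  thus False by (auto simp: mult_less_cancel_left)
qed

text \<open>The statistic is increasing in \<open>x\<close>, so its multiples are monotone and have
  no valley, whatever the sign of \<theta>.\<close>

lemma weibull_superlevel:
  assumes "a > 0" shows "convex {x\<in>{0<..}. r \<le> \<theta> \<bullet> weibull_stat a x}"
proof (rule convex_superlevel_real)
  fix x y z :: real
  assume *: "0 < x" "x < z" "z < y" "\<theta> \<bullet> weibull_stat a z < \<theta> \<bullet> weibull_stat a x" "\<theta> \<bullet> weibull_stat a z < \<theta> \<bullet> weibull_stat a y"
  have "x powr a < z powr a" "z powr a < y powr a" using * assms by (auto intro: powr_less_mono2)
  thus False using * by (auto simp: weibull_stat_def mult_less_cancel_left)
qed

lemma concave_on_superlevel_convex:
  assumes "concave_on S f" shows "convex {x\<in>S. r \<le> f x}"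
proof (rule convexI)
  fix x y and u v :: real
  assume *: "x \<in> {x\<in>S. r \<le> f x}" "y \<in> {x\<in>S. r \<le> f x}" "0 \<le> u" "0 \<le> v" "u + v = 1"
  have "u *\<^sub>R x + v *\<^sub>R y \<in> S" using assms * unfolding concave_on_iff by (auto intro: convexD)
  moreover have "u * f x + v * f y \<le> f (u *\<^sub>R x + v *\<^sub>R y)" using assms * unfolding concave_on_iff by blast
  moreover have "u * r + v * r \<le> u * f x + v * f y" using * by (intro add_mono mult_left_mono) auto
  hence "r \<le> u * f x + v * f y" using * by (simp flip: distrib_right)
  ultimately show "u *\<^sub>R x + v *\<^sub>R y \<in> {x\<in>S. r \<le> f x}" by auto
qed

text \<open>For a \<ge> 0 the log-density is concave; for a < 0 and b \<le> 0 it is not concave in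
  general but decreasing; and b > 0 contradicts integrability.\<close>

lemma gamma_superlevel:
  assumes "\<theta> \<in> natural_params pos_lborel gamma_stat"
  shows "convex {x\<in>{0<..}. r \<le> \<theta> \<bullet> gamma_stat x}"
proof -
  obtain a b where \<theta>: "\<theta> = (a, b)" by (cases \<theta>)
  have f: "\<theta> \<bullet> gamma_stat x = a * ln x + b * x" for x by (simp add: \<theta> gamma_stat_def inner_Pair)
  consider "a \<ge> 0" | "a < 0" "b \<le> 0" | "b > 0" by linarith
  thus ?thesis
  proof cases
    case 1
    have "concave_on {0<..} (\<lambda>x. a * ln x + b * x)"
      unfolding concave_on_iff
    proof (intro conjI ballI allI impI)
      fix x y u v :: real assume *: "x \<in> {0<..}" "y \<in> {0<..}" "0 \<le> u" "0 \<le> v" "u + v = 1"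
      have "u * ln x + v * ln y \<le> ln (u *\<^sub>R x + v *\<^sub>R y)" using ln_concave * unfolding concave_on_iff by blast
      from mult_left_mono[OF this 1]
      show "u * (a * ln x + b * x) + v * (a * ln y + b * y) \<le> a * ln (u *\<^sub>R x + v *\<^sub>R y) + b * (u *\<^sub>R x + v *\<^sub>R y)"
        by (simp add: algebra_simps)
    qed simp
    thus ?thesis unfolding f by (rule concave_on_superlevel_convex)
  next
    case 2
    show ?thesis
    proof (rule convex_superlevel_real)
      fix x y z :: real assume *: "0 < x" "x < z" "z < y" "\<theta> \<bullet> gamma_stat z < \<theta> \<bullet> gamma_stat y"
      have "a * ln z \<ge> a * ln y" "b * z \<ge> b * y" using 2 * by (auto intro: mult_left_mono_neg)
      thus False using * by (simp add: f)
    qed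
  next
    case 3
    have "eventually (\<lambda>x. a * ln x + b * x \<ge> 0) at_top" using 3 by real_asymp
    thus ?thesis using not_natural_paramI[of \<theta> gamma_stat] assms by (simp add: f)
  qed
qed

text \<open>In the variable ln x the log-density is a quadratic polynomial, which integrability
  forces to have b \<le> 0; the increasing substitution carries intervals to intervals.\<close>

lemma lognormal_superlevel:
  assumes "\<theta> \<in> natural_params pos_lborel lognormal_stat"
  shows "convex {x\<in>{0<..}. r \<le> \<theta> \<bullet> lognormal_stat x}"
proof -
  obtain a b where \<theta>: "\<theta> = (a, b)" by (cases \<theta>)
  have f: "\<theta> \<bullet> lognormal_stat x = a * ln x + b * (ln x)\<^sup>2" for x by (simp add: \<theta> lognormal_stat_def inner_Pair)
  have "b \<le> 0"
  proof (rule ccontr)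
    assume "\<not> b \<le> 0"
    hence "b > 0" by simp
    hence "eventually (\<lambda>x. a * ln x + b * (ln x)\<^sup>2 \<ge> 0) at_top" by real_asymp
    thus False using not_natural_paramI[of \<theta> lognormal_stat] assms by (simp add: f)
  qed
  show ?thesis
  proof (rule convex_superlevel_real)
    fix x y z :: real
    assume *: "0 < x" "x < z" "z < y" "\<theta> \<bullet> lognormal_stat z < \<theta> \<bullet> lognormal_stat x" "\<theta> \<bullet> lognormal_stat z < \<theta> \<bullet> lognormal_stat y"
    define p q r where "p = ln x" and "q = ln z" and "r = ln y"
    have lt: "p < q" "q < r" using * by (auto simp: p_def q_def r_def)
    \<comment> \<open>The second factors are the chord slopes of the quadratic on both sides of the
      supposed valley; they would increase, although their difference is
      \<open>b * (r - p)\<close>.\<close>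
    have "(q - p) * (a + b * (p + q)) < 0" "0 < (r - q) * (a + b * (q + r))"
      using * unfolding f p_def[symmetric] q_def[symmetric] r_def[symmetric]
      by (simp_all add: algebra_simps power2_eq_square)
    hence "a + b * (p + q) < 0" "a + b * (q + r) > 0" using lt by (auto simp: mult_less_0_iff zero_less_mult_iff)
    hence "0 < b * (r - p)" by (simp add: algebra_simps)
    moreover have "b * (r - p) \<le> 0" using \<open>b \<le> 0\<close> lt by (intro mult_nonpos_nonneg) auto
    ultimately show False by simp
  qed
qed

section \<open>Quadratic forms and the normal family\<close>

lemma quad_monomial_eq: "\<exists>i j. \<forall>x :: real^'d. quad_monomial x u = x $ i * x $ j"
  by (cases "rep_uprod u") (auto simp: quad_monomial.rep_eq)

text \<open>Each unordered pair is counted once, so for distinct coordinates its coefficient is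
  twice the entry of the symmetric matrix of the form.\<close>

definition quad_form :: "real^('d uprod) \<Rightarrow> real^'d \<Rightarrow> real" where
  "quad_form b x = b \<bullet> (\<chi> u. quad_monomial x u)"

lemma quad_form_sum: "quad_form b x = (\<Sum>u\<in>UNIV. b $ u * quad_monomial x u)"
  by (simp add: quad_form_def inner_vec_def)

text \<open>The last term is the exact deviation from linearity, so concavity is decided by the sign
  of the form at differences \<open>x - y\<close>. Each coordinate is a product of two entries of
  the vector, which reduces the identity to algebra.\<close>

lemma quad_form_convex_comb:
  assumes "u + v = 1"
  shows "quad_form b (u *\<^sub>R x + v *\<^sub>R y) = u * quad_form b x + v * quad_form b y - u * v * quad_form b (x - y)"
proof -
  have u: "u = 1 - v" using assms by simp
  have "quad_monomial (u *\<^sub>R x + v *\<^sub>R y) w =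
      u * quad_monomial x w + v * quad_monomial y w - u * v * quad_monomial (x - y) w" for w
  proof -
    obtain i j where q: "\<And>x :: real^'a. quad_monomial x w = x $ i * x $ j" using quad_monomial_eq[of w] by blast
    show ?thesis unfolding q u by (simp add: algebra_simps)
  qed
  note eq = this
  show ?thesis
    unfolding quad_form_sum eq by (simp add: sum_distrib_left sum.distrib sum_subtractf algebra_simps)
qed

text \<open>The coefficient of \<open>h\<close> is the polarised form, twice the symmetric bilinear
  form at \<open>x\<close> and \<open>v\<close>; what matters is that it does not depend on
  \<open>h\<close>.\<close>

lemma quad_form_ray:
  "quad_form b (x + h *\<^sub>R v) =
    quad_form b x + h * (quad_form b (x + v) - quad_form b x - quad_form b v) + h\<^sup>2 * quad_form b v"
proof -
  have "quad_monomial (x + h *\<^sub>R v) w =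
      quad_monomial x w + h * (quad_monomial (x + v) w - quad_monomial x w - quad_monomial v w) + h\<^sup>2 * quad_monomial v w" for w
  proof -
    obtain i j where q: "\<And>x :: real^'a. quad_monomial x w = x $ i * x $ j" using quad_monomial_eq[of w] by blast
    show ?thesis unfolding q by (simp add: algebra_simps power2_eq_square)
  qed
  note eq = this
  show ?thesis
    unfolding quad_form_sum eq by (simp add: sum_distrib_left sum.distrib sum_subtractf algebra_simps)
qed

lemma continuous_normal_stat: "continuous_on UNIV (normal_stat :: real^'d \<Rightarrow> _)"
proof -
  have "continuous_on UNIV (\<lambda>x :: real^'d. quad_monomial x u)" for u
  proof -
    obtain i j where q: "\<And>x :: real^'d. quad_monomial x u = x $ i * x $ j" using quad_monomial_eq[of u] by blast
    show ?thesis unfolding q by (intro continuous_intros)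
  qed
  thus ?thesis
    unfolding normal_stat_def by (intro continuous_on_Pair continuous_on_id continuous_on_vec_lambda)
qed

lemma inner_normal_stat: "(a, b) \<bullet> normal_stat x = a \<bullet> x + quad_form b x"
  by (simp add: normal_stat_def inner_Pair quad_form_def)

text \<open>Translating by \<open>n v\<close> leaves the integral unchanged, but when the quadratic part is positive at \<open>v\<close>
  the translated integrands tend to infinity pointwise; Fatou's lemma excludes this.\<close>

lemma normal_natural_params_nonpos:
  fixes a v :: "real^'d"
  assumes "(a, b) \<in> natural_params lborel normal_stat"
  shows "quad_form b v \<le> 0"
proof (rule ccontr)
  assume "\<not> ?thesis"
  hence qv: "quad_form b v > 0" by simp
  define f where "f x = (a, b) \<bullet> normal_stat x" for x
  have [measurable]: "f \<in> borel_measurable borel"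
    unfolding f_def by (intro borel_measurable_continuous_onI continuous_intros continuous_normal_stat)
  define I where "I = (\<integral>\<^sup>+x. ennreal (exp (f x)) \<partial>lborel)"
  have fin: "I < \<infinity>" using assms by (simp add: I_def f_def natural_params_def)
  have shift: "(\<integral>\<^sup>+x. ennreal (exp (f (x + real n *\<^sub>R v))) \<partial>lborel) = I" for n
  proof -
    have "I = (\<integral>\<^sup>+x. ennreal (exp (f x)) \<partial>distr lborel borel ((+) (real n *\<^sub>R v)))"
      unfolding I_def by (simp add: lborel_distr_plus)
    also have "\<dots> = (\<integral>\<^sup>+x. ennreal (exp (f (real n *\<^sub>R v + x))) \<partial>lborel)" by (subst nn_integral_distr) auto
    finally show ?thesis by (simp add: add.commute)
  qed
  have lim: "liminf (\<lambda>n. ennreal (exp (f (x + real n *\<^sub>R v)))) = \<infinity>" for x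
  proof -
    \<comment> \<open>The linear coefficient depends on \<open>x\<close> but not on
      \<open>n\<close>, so for each fixed \<open>x\<close> the positive quadratic term
      dominates.\<close>
    define k where "k = a \<bullet> v + (quad_form b (x + v) - quad_form b x - quad_form b v)"
    have "f (x + real n *\<^sub>R v) = f x + real n * k + (real n)\<^sup>2 * quad_form b v" for n
      unfolding f_def inner_normal_stat quad_form_ray k_def by (simp add: inner_add_right algebra_simps)
    moreover have "filterlim (\<lambda>n. exp (f x + real n * k + (real n)\<^sup>2 * quad_form b v)) at_top sequentially"
      using qv by real_asymp
    ultimately have "filterlim (\<lambda>n. exp (f (x + real n *\<^sub>R v))) at_top sequentially" by simp
    hence "(\<lambda>n. ennreal (exp (f (x + real n *\<^sub>R v)))) \<longlonglongrightarrow> \<infinity>"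
      by (simp add: ennreal_tendsto_top_eq_at_top)
    thus ?thesis by (intro lim_imp_Liminf) auto
  qed
  have "\<infinity> = (\<integral>\<^sup>+(x :: real^'d). \<infinity> \<partial>lborel)" by (simp add: emeasure_lborel_UNIV)
  also have "\<dots> = (\<integral>\<^sup>+x. liminf (\<lambda>n. ennreal (exp (f (x + real n *\<^sub>R v)))) \<partial>lborel)" by (simp add: lim)
  also have "\<dots> \<le> liminf (\<lambda>n. \<integral>\<^sup>+x. ennreal (exp (f (x + real n *\<^sub>R v))) \<partial>lborel)"
    by (rule nn_integral_liminf) measurable
  also have "\<dots> = I" by (simp add: shift Liminf_const)
  finally show False using fin by (simp add: top_unique)
qed

text \<open>The quadratic part is nonpositive in every direction, in particular at
  \<open>x - y\<close>, so the exact formula for convex combinations gives concavity.\<close>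

lemma normal_superlevel:
  assumes "\<theta> \<in> natural_params lborel (normal_stat :: real^'d \<Rightarrow> _)"
  shows "convex {x\<in>UNIV. r \<le> \<theta> \<bullet> normal_stat x}"
proof (rule concave_on_superlevel_convex)
  obtain a b where \<theta>: "\<theta> = (a, b)" by (cases \<theta>)
  show "concave_on UNIV (\<lambda>x. \<theta> \<bullet> normal_stat x)"
    unfolding concave_on_iff \<theta> inner_normal_stat
  proof (intro conjI ballI allI impI)
    fix x y :: "real^'d" and u v :: real assume uv: "0 \<le> u" "0 \<le> v" "u + v = 1"
    have "u * v * quad_form b (x - y) \<le> 0"
      using normal_natural_params_nonpos[of a b "x - y"] assms uv
      by (intro mult_nonneg_nonpos mult_nonneg_nonneg) (auto simp: \<theta>)
    thus "u * (a \<bullet> x + quad_form b x) + v * (a \<bullet> y + quad_form b y) \<le>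
        a \<bullet> (u *\<^sub>R x + v *\<^sub>R y) + quad_form b (u *\<^sub>R x + v *\<^sub>R y)"
      unfolding quad_form_convex_comb[OF uv(3)] by (simp add: inner_add_right algebra_simps)
  qed simp
qed

theorem corollary1p1:
  fixes \<sigma> \<theta>\<^sub>0 :: real and t :: nat and M :: "'w measure"
  assumes "py_params \<sigma> \<theta>\<^sub>0"
    and "t \<ge> 1"
    and "\<not> (\<sigma> < 0 \<and> \<theta>\<^sub>0 = real t * \<bar>\<sigma>\<bar>)"
  shows
    \<comment> \<open>multivariate normal\<close>
    "(\<forall>\<xi> \<nu> (X :: nat \<Rightarrow> 'w \<Rightarrow> real^'d).
       let F = exp_family lborel normal_stat; \<pi> = conj_prior lborel normal_stat \<xi> \<nu> in
       (\<xi>, \<nu>) \<in> conj_params lborel (normal_stat :: real^'d \<Rightarrow> _) \<longrightarrow>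
       finite_marginals F \<pi> \<longrightarrow> iid_mixture M t F X \<longrightarrow>
       (AE \<omega> in M. \<not> consistent_for \<sigma> \<theta>\<^sub>0 F \<pi> (\<lambda>j. X j \<omega>) t \<and>
          limsup (\<lambda>n. ereal (posterior \<sigma> \<theta>\<^sub>0 F \<pi> n (\<lambda>j. X j \<omega>) t)) < 1)) \<and>
    \<comment> \<open>exponential\<close>
     (\<forall>\<xi> \<nu> (X :: nat \<Rightarrow> 'w \<Rightarrow> real).
       let F = exp_family pos_lborel (\<lambda>x. x); \<pi> = conj_prior pos_lborel (\<lambda>x. x) \<xi> \<nu> in
       (\<xi>, \<nu>) \<in> conj_params pos_lborel (\<lambda>x. x) \<longrightarrow>
       finite_marginals F \<pi> \<longrightarrow> iid_mixture M t F X \<longrightarrow>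
       (AE \<omega> in M. \<not> consistent_for \<sigma> \<theta>\<^sub>0 F \<pi> (\<lambda>j. X j \<omega>) t \<and>
          limsup (\<lambda>n. ereal (posterior \<sigma> \<theta>\<^sub>0 F \<pi> n (\<lambda>j. X j \<omega>) t)) < 1)) \<and>
    \<comment> \<open>gamma\<close>
     (\<forall>\<xi> \<nu> (X :: nat \<Rightarrow> 'w \<Rightarrow> real).
       let F = exp_family pos_lborel gamma_stat; \<pi> = conj_prior pos_lborel gamma_stat \<xi> \<nu> in
       (\<xi>, \<nu>) \<in> conj_params pos_lborel gamma_stat \<longrightarrow>
       finite_marginals F \<pi> \<longrightarrow> iid_mixture M t F X \<longrightarrow>
       (AE \<omega> in M. \<not> consistent_for \<sigma> \<theta>\<^sub>0 F \<pi> (\<lambda>j. X j \<omega>) t \<and>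
          limsup (\<lambda>n. ereal (posterior \<sigma> \<theta>\<^sub>0 F \<pi> n (\<lambda>j. X j \<omega>) t)) < 1)) \<and>
    \<comment> \<open>log-normal\<close>
     (\<forall>\<xi> \<nu> (X :: nat \<Rightarrow> 'w \<Rightarrow> real).
       let F = exp_family pos_lborel lognormal_stat; \<pi> = conj_prior pos_lborel lognormal_stat \<xi> \<nu> in
       (\<xi>, \<nu>) \<in> conj_params pos_lborel lognormal_stat \<longrightarrow>
       finite_marginals F \<pi> \<longrightarrow> iid_mixture M t F X \<longrightarrow>
       (AE \<omega> in M. \<not> consistent_for \<sigma> \<theta>\<^sub>0 F \<pi> (\<lambda>j. X j \<omega>) t \<and>
          limsup (\<lambda>n. ereal (posterior \<sigma> \<theta>\<^sub>0 F \<pi> n (\<lambda>j. X j \<omega>) t)) < 1)) \<and>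
    \<comment> \<open>Weibull with fixed shape\<close>
     (\<forall>(a :: real) \<xi> \<nu> (X :: nat \<Rightarrow> 'w \<Rightarrow> real).
       let L = weibull_base a; s = weibull_stat a; F = exp_family L s; \<pi> = conj_prior L s \<xi> \<nu> in
       a > 0 \<longrightarrow> (\<xi>, \<nu>) \<in> conj_params L s \<longrightarrow>
       finite_marginals F \<pi> \<longrightarrow> iid_mixture M t F X \<longrightarrow>
       (AE \<omega> in M. \<not> consistent_for \<sigma> \<theta>\<^sub>0 F \<pi> (\<lambda>j. X j \<omega>) t \<and>
          limsup (\<lambda>n. ereal (posterior \<sigma> \<theta>\<^sub>0 F \<pi> n (\<lambda>j. X j \<omega>) t)) < 1)) \<and>
    \<comment> \<open>discrete families\<close>
     (\<forall>(F :: (real^'k, real^'e) family) \<pi> (X :: nat \<Rightarrow> 'w \<Rightarrow> real^'e).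
       discrete_family F \<longrightarrow>
       (\<Inter>\<theta>\<in>param_space F. {x \<in> space (base F). dens F \<theta> x > 0}) \<noteq> {} \<longrightarrow>
       prior_density F \<pi> \<longrightarrow>
       finite_marginals F \<pi> \<longrightarrow> iid_mixture M t F X \<longrightarrow>
       (AE \<omega> in M. \<not> consistent_for \<sigma> \<theta>\<^sub>0 F \<pi> (\<lambda>j. X j \<omega>) t \<and>
          limsup (\<lambda>n. ereal (posterior \<sigma> \<theta>\<^sub>0 F \<pi> n (\<lambda>j. X j \<omega>) t)) < 1))"
proof -
  have pos: "space pos_lborel = {0<..}" by (simp add: pos_lborel_def space_restrict_space)
  have wb: "space (weibull_base a) = {0<..}" for a by (simp add: weibull_base_def pos)
  have meas: "f \<in> borel_measurable pos_lborel" if "f \<in> borel_measurable borel" for f :: "real \<Rightarrow> 'q::topological_space"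
    using that unfolding pos_lborel_def by (intro measurable_restrict_space1) simp
  have m_normal: "normal_stat \<in> borel_measurable lborel"
    using borel_measurable_continuous_onI[OF continuous_normal_stat] by simp
  have m_gamma: "gamma_stat \<in> borel_measurable pos_lborel"
    unfolding gamma_stat_def by (rule meas) measurable
  have m_lognormal: "lognormal_stat \<in> borel_measurable pos_lborel"
    unfolding lognormal_stat_def by (rule meas) measurable
  have m_weibull: "weibull_stat a \<in> borel_measurable (weibull_base a)" for a
    unfolding weibull_base_def weibull_stat_def by (subst measurable_cong_sets[OF sets_density refl]) (rule meas, measurable)
  note main = exp_family_inconsistent[OF assms]
  show ?thesis
    unfolding Let_def
  proof (intro conjI allI impI, goal_cases)
    case 1
    show ?case by (rule main[OF regular_base_lborel m_normal _ 1(2,3)]) (simp only: space_lborel space_borel normal_superlevel)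
  next
    case 2
    show ?case
      by (rule main[OF regular_base_pos_lborel meas[OF measurable_ident_sets[OF refl]] _ 2(2,3)])
        (simp only: pos exponential_superlevel)
  next
    case 3
    show ?case by (rule main[OF regular_base_pos_lborel m_gamma _ 3(2,3)]) (simp only: pos gamma_superlevel)
  next
    case 4
    show ?case by (rule main[OF regular_base_pos_lborel m_lognormal _ 4(2,3)]) (simp only: pos lognormal_superlevel)
  next
    case 5
    \<comment> \<open>Here \<open>a > 0\<close> is the first premise, which shifts the indices of
      the others by one.\<close>
    show ?case by (rule main[OF regular_base_weibull m_weibull _ 5(3,4)]) (simp only: wb weibull_superlevel[OF 5(1)])
  next
    case 6
    from discrete_inconsistent[OF assms 6] show ?case
      by (rule AE_mp) (auto intro!: AE_I2 not_consistent_if_limsup_less_one)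
  qed
qed

end
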